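(* Let $k$ be a field and let $m,n$ be integers such that $m\ge 4$, $n\ge 6$, and $\frac23 n\ge m\ge \frac12 n+1$. Let $T=k[[X_1,\ldots,X_n]]$ be the formal power series ring and let $$F_1=\{X_1,\ldots,X_m\},\quad F_2=\{X_{n-m+1},\ldots,X_n\},\quad F_3=\{X_{m+1},\ldots,X_n\}\cup\{X_1,\ldots,X_{2m-n}\}.$$ Let $P_i=(F_i)$ be the prime ideal of $T$ generated by $F_i$, $A=T/(P_1\cap P_2\cap P_3)$, and $B=T/P_1\oplus T/P_2\oplus T/P_3$. Then $\operatorname{depth}_A B/A=0$ and hence $\operatorname{depth}A=1$.
   Context: $A$ is regarded as a subring of $B$ via the diagonal embedding, so $B/A$ is an $A$-module; depth is taken with respect to the maximal ideal of the local ring $A$. *)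

theory Defs
  imports
    Complex_Main
    "HOL-Algebra.Indexed_Polynomials"
    "HOL-Algebra.Chinese_Remainder"
    "HOL-Algebra.Module"
    "HOL-Library.Extended_Nat"
begin

section \<open>Formal power series in several variables\<close>

text \<open>As for the indexed polynomials of \<^theory>\<open>HOL-Algebra.Indexed_Polynomials\<close>, monomials are
  multisets of indices and a series maps each monomial to its coefficient, so that
  \<^const>\<open>ring.indexed_const\<close>, \<^const>\<open>ring.indexed_var\<close> and \<^const>\<open>ring.indexed_padd\<close> can be
  reused; no finiteness of the support is required. The variables are indexed by \<open>I\<close>.\<close>

definition (in ring) power_series_ring :: "'c set \<Rightarrow> ('c multiset \<Rightarrow> 'a) ring"
  where "power_series_ring I =
    \<lparr> carrier = {f. carrier_coeff f \<and> (\<forall>i. i \<notin> I \<longrightarrow> index_free f i)},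
      monoid.mult = (\<lambda>f g m. \<Oplus>p \<in> {p. p \<subseteq># m}. f p \<otimes> g (m - p)),
      one = indexed_const \<one>,
      zero = indexed_const \<zero>,
      add = indexed_padd \<rparr>"


section \<open>Modules\<close>

text \<open>The codomain \<open>S\<close> of a ring homomorphism \<open>h\<close>, as a module over the domain of \<open>h\<close>.\<close>

definition restrict_scalars :: "('a \<Rightarrow> 'b) \<Rightarrow> ('b, 'm) ring_scheme \<Rightarrow> ('a, 'b) module"
  where "restrict_scalars h S =
    \<lparr> carrier = carrier S, monoid.mult = monoid.mult S, one = one S, zero = zero S, add = add S,
      smult = (\<lambda>a x. h a \<otimes>\<^bsub>S\<^esub> x) \<rparr>"

abbreviation self_module :: "('a, 'm) ring_scheme \<Rightarrow> ('a, 'a) module"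
  where "self_module R \<equiv> restrict_scalars (\<lambda>a. a) R"

text \<open>The fields \<open>mult\<close> and \<open>one\<close> of a module record play no role in \<^locale>\<open>module\<close>.\<close>

definition quot_module :: "('a, 'b, 'm) module_scheme \<Rightarrow> 'b set \<Rightarrow> ('a, 'b set) module"
  where "quot_module M N =
    \<lparr> carrier = a_rcosets\<^bsub>M\<^esub> N, monoid.mult = undefined, one = undefined,
      zero = N, add = set_add M,
      smult = (\<lambda>a C. \<Union>x\<in>C. N +>\<^bsub>M\<^esub> (a \<odot>\<^bsub>M\<^esub> x)) \<rparr>"

text \<open>The submodule \<open>S M\<close> generated by the products of elements of \<open>S\<close> and \<open>M\<close>. It
  coincides with \<open>J M\<close> for \<open>J\<close> the ideal generated by \<open>S\<close>; in particular,
  for \<open>S = {x\<^sub>1, \<dots>, x\<^sub>r}\<close> it is \<open>(x\<^sub>1, \<dots>, x\<^sub>r) M\<close>.\<close>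

definition set_smult ::
    "('a, 'n) ring_scheme \<Rightarrow> ('a, 'b, 'm) module_scheme \<Rightarrow> 'a set \<Rightarrow> 'b set"
  where "set_smult R M S =
    \<Inter>{N. submodule N R M \<and> (\<forall>a\<in>S. \<forall>x\<in>carrier M. a \<odot>\<^bsub>M\<^esub> x \<in> N)}"


section \<open>Regular sequences and depth\<close>

definition nonzerodivisor_on :: "('a, 'b, 'm) module_scheme \<Rightarrow> 'a \<Rightarrow> bool"
  where "nonzerodivisor_on M a \<longleftrightarrow> (\<forall>x\<in>carrier M. a \<odot>\<^bsub>M\<^esub> x = \<zero>\<^bsub>M\<^esub> \<longrightarrow> x = \<zero>\<^bsub>M\<^esub>)"

definition regular_sequence ::
    "('a, 'n) ring_scheme \<Rightarrow> ('a, 'b, 'm) module_scheme \<Rightarrow> 'a list \<Rightarrow> bool"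
  where "regular_sequence R M xs \<longleftrightarrow>
    set xs \<subseteq> carrier R \<and>
    (\<forall>i<length xs. nonzerodivisor_on (quot_module M (set_smult R M (set (take i xs)))) (xs ! i)) \<and>
    set_smult R M (set xs) \<noteq> carrier M"

text \<open>The depth (grade) of \<open>M\<close> with respect to an ideal \<open>J\<close>, with the usual convention
  that it is infinite if \<open>J M = M\<close>.\<close>

definition ideal_depth ::
    "('a, 'n) ring_scheme \<Rightarrow> 'a set \<Rightarrow> ('a, 'b, 'm) module_scheme \<Rightarrow> enat"
  where "ideal_depth R J M =
    (if set_smult R M J = carrier M then \<infinity>
     else (SUP xs\<in>{xs. set xs \<subseteq> J \<and> regular_sequence R M xs}. enat (length xs)))"

text \<open>The depth over a local ring \<open>R\<close>; the definite description is meaningful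
  only if \<open>R\<close> has exactly one maximal ideal.\<close>

definition depth :: "('a, 'n) ring_scheme \<Rightarrow> ('a, 'b, 'm) module_scheme \<Rightarrow> enat"
  where "depth R M = ideal_depth R (THE J. maximalideal J R) M"


section \<open>The diagonal embedding\<close>

text \<open>The map \<open>T/I \<rightarrow> T/P\<^sub>1 \<oplus> T/P\<^sub>2 \<oplus> T/P\<^sub>3\<close> sending the class of \<open>t\<close> to
  the triple of classes of \<open>t\<close>, for an ideal \<open>I\<close> contained in all the \<open>P\<^sub>i\<close>: then
  \<open>P\<^sub>i + (I + t) = P\<^sub>i + t\<close>.\<close>

definition diagonal ::
    "('a, 'm) ring_scheme \<Rightarrow> 'a set \<Rightarrow> 'a set \<Rightarrow> 'a set \<Rightarrow> 'a set \<Rightarrow> 'a set \<times> 'a set \<times> 'a set"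
  where "diagonal T P1 P2 P3 C = (P1 <+>\<^bsub>T\<^esub> C, P2 <+>\<^bsub>T\<^esub> C, P3 <+>\<^bsub>T\<^esub> C)"

end

theory Submission
  imports Defs
begin

text \<open>
  Let \<open>\<mm> = (X\<^sub>1, \<dots>, X\<^sub>n)\<close>. Every variable lies in \<open>F\<^sub>1\<close> or in \<open>F\<^sub>2 \<inter> F\<^sub>3\<close>, so that
  \<open>\<mm> = P\<^sub>1 + (P\<^sub>2 \<inter> P\<^sub>3)\<close>. If \<open>t \<in> \<mm>\<close>, then some \<open>w \<in> P\<^sub>2 \<inter> P\<^sub>3\<close> is congruent to \<open>t\<close> modulo \<open>P\<^sub>1\<close>,
  which says \<open>t (1, 0, 0) = (w, w, w)\<close> in \<open>B\<close>. Hence the class of \<open>(1, 0, 0)\<close> is a nonzero element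
  of \<open>B/A\<close> annihilated by the maximal ideal, and \<open>depth B/A = 0\<close>.

  For \<open>A\<close>: the class of \<open>X\<^sub>1 + X\<^sub>m + X\<^sub>n\<close> is regular, because modulo each \<open>P\<^sub>i\<close> exactly one of the
  three variables survives. If \<open>y\<close> is any regular element and \<open>w\<close> is the element with
  \<open>y (1, 0, 0) = (w, w, w)\<close>, then \<open>w \<notin> y A\<close> but \<open>\<mm> w \<subseteq> y A\<close>, so that no regular sequence starting
  with \<open>y\<close> has a second element.
\<close>

section \<open>Modules, quotients and depth\<close>

lemma module_restrict_scalars:
  assumes "cring R" and "ring S" and h: "h \<in> ring_hom R S"
  shows "module R (restrict_scalars h S)"
proof -
  interpret R: cring R by fact
  interpret S: ring S by fact
  have ag: "abelian_group (restrict_scalars h S)"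
    unfolding restrict_scalars_def by (rule abelian_groupI)
      (auto simp: S.a_ac intro: S.l_neg S.add.inv_closed)
  show ?thesis
    by (rule moduleI)
      (simp_all add: ag assms(1), simp_all add: restrict_scalars_def ring_hom_closed[OF h]
        ring_hom_add[OF h] ring_hom_mult[OF h] ring_hom_one[OF h] S.l_distr S.r_distr S.m_assoc)
qed

lemma module_self_module:
  assumes "cring R" shows "module R (self_module R)"
  by (rule module_restrict_scalars)
    (use assms cring.axioms(1) in \<open>auto simp: ring_hom_def\<close>)

section \<open>Submodules and quotient modules\<close>

context module
begin

lemma submodule_abelian_subgroup:
  assumes "submodule N R M" shows "abelian_subgroup N M"
  by (rule abelian_subgroupI3)
    (use assms M.abelian_group_axioms in \<open>auto simp: additive_subgroup_def submodule_def\<close>)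

text \<open>Closure under negation comes from scalar multiplication by
  \<open>\<ominus> \<one>\<close>, so closure under sums and scalars suffices.\<close>

lemma submoduleI_smult:
  assumes "H \<subseteq> carrier M" "\<zero>\<^bsub>M\<^esub> \<in> H"
    and "\<And>a b. a \<in> H \<Longrightarrow> b \<in> H \<Longrightarrow> a \<oplus>\<^bsub>M\<^esub> b \<in> H"
    and smult: "\<And>a x. a \<in> carrier R \<Longrightarrow> x \<in> H \<Longrightarrow> a \<odot>\<^bsub>M\<^esub> x \<in> H"
  shows "submodule H R M"
proof (rule submoduleI)
  show "\<ominus>\<^bsub>M\<^esub> a \<in> H" if "a \<in> H" for a
    using smult[of "\<ominus> \<one>" a] that assms(1) by (auto simp: smult_l_minus subset_iff)
qed (use assms in auto)

lemma submodule_zero: "submodule {\<zero>\<^bsub>M\<^esub>} R M"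
  by (rule submoduleI) auto

lemma submodule_zero_closed: "submodule N R M \<Longrightarrow> \<zero>\<^bsub>M\<^esub> \<in> N"
  using submodule_abelian_subgroup
  by (metis abelian_subgroup.axioms(1) additive_subgroup.zero_closed)

lemma submodule_mult_image:
  assumes "y \<in> carrier R"
  shows "submodule ((\<lambda>v. y \<odot>\<^bsub>M\<^esub> v) ` carrier M) R M"
proof (rule submoduleI_smult)
  show "\<zero>\<^bsub>M\<^esub> \<in> (\<lambda>v. y \<odot>\<^bsub>M\<^esub> v) ` carrier M"
    using assms by (metis M.zero_closed imageI smult_r_null)
  show "a \<oplus>\<^bsub>M\<^esub> b \<in> (\<lambda>v. y \<odot>\<^bsub>M\<^esub> v) ` carrier M"
    if "a \<in> (\<lambda>v. y \<odot>\<^bsub>M\<^esub> v) ` carrier M" "b \<in> (\<lambda>v. y \<odot>\<^bsub>M\<^esub> v) ` carrier M" for a b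
    using that assms by (auto simp: smult_r_distr[symmetric])
  show "a \<odot>\<^bsub>M\<^esub> b \<in> (\<lambda>v. y \<odot>\<^bsub>M\<^esub> v) ` carrier M"
    if "a \<in> carrier R" "b \<in> (\<lambda>v. y \<odot>\<^bsub>M\<^esub> v) ` carrier M" for a b
  proof -
    from that(2) obtain v where v: "v \<in> carrier M" "b = y \<odot>\<^bsub>M\<^esub> v" by auto
    have "a \<odot>\<^bsub>M\<^esub> b = y \<odot>\<^bsub>M\<^esub> (a \<odot>\<^bsub>M\<^esub> v)"
      using that(1) v assms by (simp add: smult_assoc1[symmetric] R.m_comm)
    then show ?thesis using that(1) v by auto
  qed
qed (use assms in auto)

lemma carrier_quot_module:
  "carrier (quot_module M N) = (\<lambda>x. N +>\<^bsub>M\<^esub> x) ` carrier M"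
  by (auto simp: quot_module_def A_RCOSETS_def')

context
  fixes N assumes N: "submodule N R M"
begin

interpretation N: abelian_subgroup N M
  by (rule submodule_abelian_subgroup[OF N])

lemma a_rcos_eq_iff:
  assumes "x \<in> carrier M" "y \<in> carrier M"
  shows "N +>\<^bsub>M\<^esub> x = N +>\<^bsub>M\<^esub> y \<longleftrightarrow> x \<ominus>\<^bsub>M\<^esub> y \<in> N"
proof -
  have "N +>\<^bsub>M\<^esub> x = N +>\<^bsub>M\<^esub> y \<longleftrightarrow> x \<in> N +>\<^bsub>M\<^esub> y"
    using assms N.a_rcos_self N.a_repr_independence' by blast
  then show ?thesis using assms by (simp add: N.a_rcos_module M.minus_eq)
qed

text \<open>The scalar action on a coset is defined as a union over all its representatives. Two
  representatives differ by an element of \<open>N\<close>, and \<open>N\<close> is stable under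
  scalars, so all members of the union are the same coset.\<close>

lemma smult_quot_module:
  assumes "a \<in> carrier R" "x \<in> carrier M"
  shows "a \<odot>\<^bsub>quot_module M N\<^esub> (N +>\<^bsub>M\<^esub> x) = N +>\<^bsub>M\<^esub> (a \<odot>\<^bsub>M\<^esub> x)"
proof -
  have "N +>\<^bsub>M\<^esub> (a \<odot>\<^bsub>M\<^esub> y) = N +>\<^bsub>M\<^esub> (a \<odot>\<^bsub>M\<^esub> x)" if y: "y \<in> N +>\<^bsub>M\<^esub> x" for y
  proof -
    have yM: "y \<in> carrier M" using y assms N.a_elemrcos_carrier by blast
    then have "y \<ominus>\<^bsub>M\<^esub> x \<in> N"
      using y assms N.a_rcos_module by (simp add: M.minus_eq)
    then have "a \<odot>\<^bsub>M\<^esub> (y \<ominus>\<^bsub>M\<^esub> x) \<in> N"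
      using assms submodule.smult_closed[OF N] by blast
    also have "a \<odot>\<^bsub>M\<^esub> (y \<ominus>\<^bsub>M\<^esub> x) = a \<odot>\<^bsub>M\<^esub> y \<ominus>\<^bsub>M\<^esub> a \<odot>\<^bsub>M\<^esub> x"
      using assms yM by (simp add: M.minus_eq smult_r_distr smult_r_minus)
    finally show ?thesis using assms yM by (subst a_rcos_eq_iff) auto
  qed
  moreover have "x \<in> N +>\<^bsub>M\<^esub> x" using assms N.a_rcos_self by blast
  ultimately have "(\<Union>y\<in>N +>\<^bsub>M\<^esub> x. N +>\<^bsub>M\<^esub> (a \<odot>\<^bsub>M\<^esub> y)) = N +>\<^bsub>M\<^esub> (a \<odot>\<^bsub>M\<^esub> x)"
    by (intro UN_constant_eq) blast+
  then show ?thesis by (simp add: quot_module_def)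
qed

lemma module_quot_module: "module R (quot_module M N)"
proof -
  have add: "(N +>\<^bsub>M\<^esub> x) \<oplus>\<^bsub>quot_module M N\<^esub> (N +>\<^bsub>M\<^esub> y) = N +>\<^bsub>M\<^esub> (x \<oplus>\<^bsub>M\<^esub> y)"
    if "x \<in> carrier M" "y \<in> carrier M" for x y
    using that by (simp add: quot_module_def N.a_rcos_sum)
  show ?thesis
  proof (rule moduleI)
    \<comment> \<open>The additive structure agrees with that of the factor group of
      \<open>M\<close> by \<open>N\<close>; once both are unfolded down to carrier, operation and
      unit, the two statements coincide.\<close>
    have "comm_group (add_monoid (quot_module M N))"
      using N.a_factorgroup_is_comm_group
      unfolding quot_module_def A_FactGroup_def' comm_group_def group_def comm_monoid_def monoid_def
        group_axioms_def comm_monoid_axioms_def Units_def partial_object.select_convs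
        monoid.select_convs ring.select_convs by assumption
    then show "abelian_group (quot_module M N)"
      by (rule comm_group_abelian_groupI)
    show "cring R" by (rule R.is_cring)
  qed (auto simp: carrier_quot_module smult_quot_module smult_l_distr smult_r_distr smult_assoc1
    add)
qed

lemma zero_quot_module: "\<zero>\<^bsub>quot_module M N\<^esub> = N"
  by (simp add: quot_module_def)

text \<open>A coset is zero in the quotient exactly when its representative lies in
  \<open>N\<close>. This moves the conditions of a regular sequence from cosets back to elements of
  \<open>M\<close>.\<close>

lemma nonzerodivisor_on_quot_module:
  assumes "a \<in> carrier R"
  shows "nonzerodivisor_on (quot_module M N) a \<longleftrightarrow>
    (\<forall>x\<in>carrier M. a \<odot>\<^bsub>M\<^esub> x \<in> N \<longrightarrow> x \<in> N)"
proof -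
  have "N +>\<^bsub>M\<^esub> x = N \<longleftrightarrow> x \<in> N" if "x \<in> carrier M" for x
    using that by (metis N.a_rcos_const N.a_rcos_self)
  then show ?thesis
    using assms by (simp add: nonzerodivisor_on_def carrier_quot_module smult_quot_module
        zero_quot_module)
qed

lemma submodule_quot_image:
  assumes L: "submodule L R M"
  shows "submodule ((\<lambda>x. N +>\<^bsub>M\<^esub> x) ` L) R (quot_module M N)"
proof -
  interpret Q: module R "quot_module M N" by (rule module_quot_module)
  have LM: "x \<in> carrier M" if "x \<in> L" for x using submoduleE(1)[OF L] that by blast
  have add: "(N +>\<^bsub>M\<^esub> x) \<oplus>\<^bsub>quot_module M N\<^esub> (N +>\<^bsub>M\<^esub> y) = N +>\<^bsub>M\<^esub> (x \<oplus>\<^bsub>M\<^esub> y)"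
    if "x \<in> carrier M" "y \<in> carrier M" for x y
    using that by (simp add: quot_module_def N.a_rcos_sum)
  show ?thesis
  proof (rule Q.submoduleI_smult)
    show "\<zero>\<^bsub>quot_module M N\<^esub> \<in> (\<lambda>x. N +>\<^bsub>M\<^esub> x) ` L"
      using submodule_zero_closed[OF L] N.a_subset
      by (auto simp: zero_quot_module intro!: image_eqI[where x = "\<zero>\<^bsub>M\<^esub>"])
    show "(\<lambda>x. N +>\<^bsub>M\<^esub> x) ` L \<subseteq> carrier (quot_module M N)"
      using LM by (auto simp: carrier_quot_module)
    show "a \<oplus>\<^bsub>quot_module M N\<^esub> b \<in> (\<lambda>x. N +>\<^bsub>M\<^esub> x) ` L"
      if "a \<in> (\<lambda>x. N +>\<^bsub>M\<^esub> x) ` L" "b \<in> (\<lambda>x. N +>\<^bsub>M\<^esub> x) ` L" for a b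
      using that submoduleE(5)[OF L] by (auto simp: add LM)
    show "a \<odot>\<^bsub>quot_module M N\<^esub> b \<in> (\<lambda>x. N +>\<^bsub>M\<^esub> x) ` L"
      if "a \<in> carrier R" "b \<in> (\<lambda>x. N +>\<^bsub>M\<^esub> x) ` L" for a b
      using that submoduleE(4)[OF L] by (auto simp: smult_quot_module LM)
  qed
qed

end

section \<open>Generated submodules, regular sequences and depth\<close>

lemma submodule_Inter:
  assumes "\<And>N. N \<in> \<N> \<Longrightarrow> submodule N R M" and "\<N> \<noteq> {}"
  shows "submodule (\<Inter>\<N>) R M"
proof (rule submoduleI)
  show "\<Inter>\<N> \<subseteq> carrier M" using assms submoduleE(1) by blast
  show "\<zero>\<^bsub>M\<^esub> \<in> \<Inter>\<N>" using assms(1) submodule_zero_closed by blast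
  show "\<ominus>\<^bsub>M\<^esub> a \<in> \<Inter>\<N>" if "a \<in> \<Inter>\<N>" for a
    using assms(1) submoduleE(3) that by blast
  show "a \<oplus>\<^bsub>M\<^esub> b \<in> \<Inter>\<N>" if "a \<in> \<Inter>\<N>" "b \<in> \<Inter>\<N>" for a b
    using assms(1) submoduleE(5) that by blast
  show "a \<odot>\<^bsub>M\<^esub> b \<in> \<Inter>\<N>" if "a \<in> carrier R" "b \<in> \<Inter>\<N>" for a b
    using assms(1) submoduleE(4) that by blast
qed

lemma submodule_set_smult:
  assumes "S \<subseteq> carrier R" shows "submodule (set_smult R M S) R M"
  unfolding set_smult_def
  by (rule submodule_Inter) (use assms carrier_is_submodule in blast)+

lemma set_smult_empty: "set_smult R M {} = {\<zero>\<^bsub>M\<^esub>}"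
  using submodule_zero submodule_zero_closed by (auto simp: set_smult_def)

lemma smult_in_set_smult: "a \<in> S \<Longrightarrow> x \<in> carrier M \<Longrightarrow> a \<odot>\<^bsub>M\<^esub> x \<in> set_smult R M S"
  by (auto simp: set_smult_def)

lemma set_smult_minimal:
  assumes "submodule N R M" "\<And>a x. a \<in> S \<Longrightarrow> x \<in> carrier M \<Longrightarrow> a \<odot>\<^bsub>M\<^esub> x \<in> N"
  shows "set_smult R M S \<subseteq> N"
  using assms by (auto simp: set_smult_def)

lemma set_smult_mono: "S \<subseteq> S' \<Longrightarrow> set_smult R M S \<subseteq> set_smult R M S'"
  by (auto simp: set_smult_def)

lemma set_smult_singleton:
  assumes "y \<in> carrier R"
  shows "set_smult R M {y} = (\<lambda>v. y \<odot>\<^bsub>M\<^esub> v) ` carrier M"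
proof
  show "set_smult R M {y} \<subseteq> (\<lambda>v. y \<odot>\<^bsub>M\<^esub> v) ` carrier M"
    by (rule set_smult_minimal[OF submodule_mult_image[OF assms]]) auto
qed (auto simp: smult_in_set_smult)

text \<open>The definition of a regular sequence tests even its first entry on a quotient, namely by
  the submodule generated by nothing; this removes that quotient.\<close>

lemma nonzerodivisor_on_quot_zero:
  assumes "y \<in> carrier R"
  shows "nonzerodivisor_on (quot_module M {\<zero>\<^bsub>M\<^esub>}) y \<longleftrightarrow> nonzerodivisor_on M y"
  by (subst nonzerodivisor_on_quot_module[OF submodule_zero assms]) (simp add: nonzerodivisor_on_def)

lemma regular_sequence_hd:
  assumes "regular_sequence R M (y # ys)"
  shows "y \<in> carrier R" "nonzerodivisor_on M y"
proof -
  show y: "y \<in> carrier R" using assms by (simp add: regular_sequence_def)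
  have "nonzerodivisor_on (quot_module M (set_smult R M {})) y"
    using assms by (auto simp: regular_sequence_def dest: spec[of _ 0])
  then show "nonzerodivisor_on M y" using y by (simp add: set_smult_empty nonzerodivisor_on_quot_zero)
qed

text \<open>All products of \<open>J\<close> with \<open>M / N\<close> lie in the image of
  \<open>L\<close>, and since \<open>N \<subseteq> L\<close> the class of \<open>e\<close> does not.
  This is how the infinite value of the depth of a quotient module is excluded.\<close>

lemma set_smult_quot_module_neq:
  assumes N: "submodule N R M" and L: "submodule L R M" "N \<subseteq> L"
    and J: "J \<subseteq> carrier R" "\<And>a x. a \<in> J \<Longrightarrow> x \<in> carrier M \<Longrightarrow> a \<odot>\<^bsub>M\<^esub> x \<in> L"
    and e: "e \<in> carrier M" "e \<notin> L"
  shows "set_smult R (quot_module M N) J \<noteq> carrier (quot_module M N)"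
proof
  interpret Q: module R "quot_module M N" by (rule module_quot_module[OF N])
  have "set_smult R (quot_module M N) J \<subseteq> (\<lambda>x. N +>\<^bsub>M\<^esub> x) ` L"
  proof (rule Q.set_smult_minimal[OF submodule_quot_image[OF N L(1)]])
    show "a \<odot>\<^bsub>quot_module M N\<^esub> x \<in> (\<lambda>x. N +>\<^bsub>M\<^esub> x) ` L"
      if "a \<in> J" "x \<in> carrier (quot_module M N)" for a x
      using that J by (auto simp: carrier_quot_module smult_quot_module[OF N] subset_iff)
  qed
  also assume "set_smult R (quot_module M N) J = carrier (quot_module M N)"
  finally obtain l where l: "l \<in> L" "N +>\<^bsub>M\<^esub> e = N +>\<^bsub>M\<^esub> l"
    using e(1) by (auto simp: carrier_quot_module)
  have lM: "l \<in> carrier M" using l(1) submoduleE(1)[OF L(1)] by blast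
  then have "e \<ominus>\<^bsub>M\<^esub> l \<in> L" using l(2) e(1) a_rcos_eq_iff[OF N] L(2) by blast
  then have "e \<ominus>\<^bsub>M\<^esub> l \<oplus>\<^bsub>M\<^esub> l \<in> L" using l(1) submoduleE(5)[OF L(1)] by blast
  also have "e \<ominus>\<^bsub>M\<^esub> l \<oplus>\<^bsub>M\<^esub> l = e"
    using e(1) lM by (simp add: M.minus_eq M.a_assoc M.l_neg)
  finally show False using e(2) by contradiction
qed

text \<open>The nonzero element \<open>u\<close> is killed by all of \<open>J\<close>, so no element
  of \<open>J\<close> can begin a regular sequence and only the empty one remains. The first
  assumption rules out the conventional value infinity.\<close>

lemma ideal_depth_eq_0:
  assumes "set_smult R M J \<noteq> carrier M"
    and u: "u \<in> carrier M" "u \<noteq> \<zero>\<^bsub>M\<^esub>" "\<And>a. a \<in> J \<Longrightarrow> a \<odot>\<^bsub>M\<^esub> u = \<zero>\<^bsub>M\<^esub>"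
  shows "ideal_depth R J M = 0"
proof -
  have "xs = []" if "set xs \<subseteq> J" "regular_sequence R M xs" for xs
  proof (cases xs)
    case (Cons y ys)
    then show ?thesis
      using regular_sequence_hd(2)[of y ys] that u by (auto simp: nonzerodivisor_on_def)
  qed
  then have "(SUP xs\<in>{xs. set xs \<subseteq> J \<and> regular_sequence R M xs}. enat (length xs)) \<le> 0"
    by (intro SUP_least) (auto simp: zero_enat_def)
  then show ?thesis using assms(1) by (simp add: ideal_depth_def)
qed

text \<open>The sequence \<open>[h]\<close> gives the lower bound. For the upper bound,
  \<open>socle\<close> provides, after any regular \<open>y\<close>, a nonzero element of
  \<open>M / y M\<close> annihilated by \<open>J\<close>; hence no element of \<open>J\<close> can
  follow \<open>y\<close>.\<close>

lemma ideal_depth_eq_1: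
  assumes J: "J \<subseteq> carrier R" "set_smult R M J \<noteq> carrier M"
    and h: "h \<in> J" "nonzerodivisor_on M h"
    and socle: "\<And>y. y \<in> J \<Longrightarrow> nonzerodivisor_on M y \<Longrightarrow>
      \<exists>w\<in>carrier M. w \<notin> (\<lambda>v. y \<odot>\<^bsub>M\<^esub> v) ` carrier M \<and>
        (\<forall>z\<in>J. z \<odot>\<^bsub>M\<^esub> w \<in> (\<lambda>v. y \<odot>\<^bsub>M\<^esub> v) ` carrier M)"
  shows "ideal_depth R J M = 1"
proof -
  let ?X = "{xs. set xs \<subseteq> J \<and> regular_sequence R M xs}"
  have hR: "h \<in> carrier R" using h J by auto
  have "length xs \<le> 1" if xs: "set xs \<subseteq> J" "regular_sequence R M xs" for xs
  proof (rule ccontr)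
    assume "\<not> length xs \<le> 1"
    then obtain y z zs where eq: "xs = y # z # zs"
      by (metis One_nat_def le_numeral_extra(4) length_Cons list.size(3) neq_Nil_conv zero_le)
    have yz: "y \<in> carrier R" "z \<in> carrier R" "y \<in> J" "z \<in> J" using xs eq J by auto
    have "nonzerodivisor_on (quot_module M (set_smult R M {y})) z"
      using xs(2) by (auto simp: regular_sequence_def eq dest: spec[of _ 1])
    then have "\<forall>x\<in>carrier M. z \<odot>\<^bsub>M\<^esub> x \<in> (\<lambda>v. y \<odot>\<^bsub>M\<^esub> v) ` carrier M \<longrightarrow>
        x \<in> (\<lambda>v. y \<odot>\<^bsub>M\<^esub> v) ` carrier M"
      using yz nonzerodivisor_on_quot_module[OF submodule_mult_image]
      by (simp add: set_smult_singleton)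
    with socle[OF yz(3)] regular_sequence_hd(2)[of y] xs(2) yz eq show False by blast
  qed
  then have "(SUP xs\<in>?X. enat (length xs)) \<le> 1"
    by (intro SUP_least) (auto simp: one_enat_def)
  \<comment> \<open>A regular sequence must also generate a proper submodule; here
    \<open>h M\<close> lies inside \<open>J M\<close>, which is proper.\<close>
  moreover have "set_smult R M {h} \<noteq> carrier M"
    using set_smult_mono[of "{h}" J] h(1) J submoduleE(1)[OF submodule_set_smult[OF J(1)]] by blast
  then have "[h] \<in> ?X"
    using h hR by (simp add: regular_sequence_def set_smult_empty nonzerodivisor_on_quot_zero)
  then have "enat (length [h]) \<le> (SUP xs\<in>?X. enat (length xs))" by (rule SUP_upper)
  ultimately show ?thesis
    using J(2) by (simp add: ideal_depth_def one_enat_def)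
qed

end

text \<open>Applied to the diagonal embedding, this makes the image of \<open>A\<close> a submodule
  of \<open>B\<close>, by which \<open>B\<close> can be divided.\<close>

lemma submodule_restrict_scalars_image:
  assumes "cring R" and "ring S" and h: "h \<in> ring_hom R S"
  shows "submodule (h ` carrier R) R (restrict_scalars h S)"
proof -
  interpret R: cring R by fact
  interpret S: ring S by fact
  interpret M: module R "restrict_scalars h S" by (rule module_restrict_scalars[OF assms])
  show ?thesis
  proof (rule M.submoduleI_smult)
    show "h ` carrier R \<subseteq> carrier (restrict_scalars h S)"
      using ring_hom_closed[OF h] by (auto simp: restrict_scalars_def)
    show "\<zero>\<^bsub>restrict_scalars h S\<^esub> \<in> h ` carrier R"
      using ring_hom_zero[OF h R.ring_axioms S.ring_axioms] R.zero_closed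
      by (metis imageI restrict_scalars_def ring.simps(1))
  qed (auto simp: restrict_scalars_def ring_hom_add[OF h, symmetric] ring_hom_mult[OF h, symmetric]
      intro!: imageI)
qed

section \<open>Power series rings\<close>

text \<open>A monomial has finitely many divisors, so each coefficient of a product of series is a
  genuine finite sum. In the induction, a submultiset either contains the new element, which is
  split off, or already lies in \<open>m\<close>.\<close>

lemma finite_submultisets [simp]: "finite {p. p \<subseteq># m}"
proof (induction m)
  case (add x m)
  have "{p. p \<subseteq># add_mset x m} \<subseteq> {p. p \<subseteq># m} \<union> add_mset x ` {p. p \<subseteq># m}"
  proof
    fix p assume p: "p \<in> {p. p \<subseteq># add_mset x m}"
    show "p \<in> {p. p \<subseteq># m} \<union> add_mset x ` {p. p \<subseteq># m}"
    proof (cases "x \<in># p")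
      case True
      then obtain q where "p = add_mset x q" by (metis multi_member_split)
      then show ?thesis using p by auto
    next
      case False
      then have "p - {#x#} = p" by (simp add: diff_single_trivial)
      then show ?thesis using p by (simp add: subset_eq_diff_conv[symmetric])
        (metis False Diff_eq_empty_iff_mset add_mset_remove_trivial diff_union_swap2
          insert_noteq_member subset_eq_diff_conv add_mset_add_single)
    qed
  qed
  then show ?case using add.IH finite_subset by blast
qed simp

lemma mset_double_diff: "p \<subseteq># m \<Longrightarrow> m - (m - p) = p"
  by (simp add: multiset_eq_iff subseteq_mset_def)

context cring
begin

lemma carrier_power_series_ring:
  "f \<in> carrier (power_series_ring I) \<longleftrightarrow>
    (\<forall>m. f m \<in> carrier R) \<and> (\<forall>m. \<not> set_mset m \<subseteq> I \<longrightarrow> f m = \<zero>)"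
  by (auto simp: power_series_ring_def carrier_coeff_def index_free_def)

lemma zero_power_series_ring: "\<zero>\<^bsub>power_series_ring I\<^esub> = (\<lambda>_. \<zero>)"
  by (simp add: power_series_ring_def indexed_zero_def)

lemma one_power_series_ring: "\<one>\<^bsub>power_series_ring I\<^esub> = (\<lambda>m. if m = {#} then \<one> else \<zero>)"
  by (simp add: power_series_ring_def indexed_const_def)

lemma add_power_series_ring: "f \<oplus>\<^bsub>power_series_ring I\<^esub> g = (\<lambda>m. f m \<oplus> g m)"
  by (simp add: power_series_ring_def indexed_padd_def)

lemma mult_power_series_ring:
  "f \<otimes>\<^bsub>power_series_ring I\<^esub> g = (\<lambda>m. \<Oplus>p \<in> {p. p \<subseteq># m}. f p \<otimes> g (m - p))"
  by (simp add: power_series_ring_def)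

lemmas power_series_ring_simps =
  zero_power_series_ring one_power_series_ring add_power_series_ring mult_power_series_ring

lemma finsum_Sigma:
  assumes "finite A" "\<And>x. x \<in> A \<Longrightarrow> finite (B x)"
    "\<And>x y. x \<in> A \<Longrightarrow> y \<in> B x \<Longrightarrow> f x y \<in> carrier R"
  shows "(\<Oplus>x\<in>A. \<Oplus>y\<in>B x. f x y) = (\<Oplus>z\<in>Sigma A B. case z of (x, y) \<Rightarrow> f x y)"
  using assms
proof (induction A)
  case (insert a A)
  have inj: "inj_on (Pair a) (B a)" by (simp add: inj_on_def)
  have eq: "Sigma (insert a A) B = Pair a ` B a \<union> Sigma A B" by auto
  have "(\<Oplus>z\<in>Sigma (insert a A) B. case z of (x, y) \<Rightarrow> f x y) =
      (\<Oplus>z\<in>Pair a ` B a. case z of (x, y) \<Rightarrow> f x y) \<oplus> (\<Oplus>z\<in>Sigma A B. case z of (x, y) \<Rightarrow> f x y)"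
    unfolding eq by (rule finsum_Un_disjoint) (use insert in auto)
  also have "(\<Oplus>z\<in>Pair a ` B a. case z of (x, y) \<Rightarrow> f x y) = (\<Oplus>y\<in>B a. f a y)"
    by (subst finsum_reindex[OF _ inj]) (use insert in auto)
  also have "(\<Oplus>z\<in>Sigma A B. case z of (x, y) \<Rightarrow> f x y) = (\<Oplus>x\<in>A. \<Oplus>y\<in>B x. f x y)"
    using insert by simp
  finally show ?case
    using insert by (subst finsum_insert) (auto simp: Pi_def)
qed simp

text \<open>Reindexing by the involution that sends a divisor \<open>p\<close> of \<open>m\<close>
  to its cofactor \<open>m - p\<close>.\<close>

lemma power_series_mult_comm:
  assumes "\<And>m. f m \<in> carrier R" "\<And>m. g m \<in> carrier R"
  shows "(\<Oplus>p\<in>{p. p \<subseteq># m}. f p \<otimes> g (m - p)) = (\<Oplus>p\<in>{p. p \<subseteq># m}. g p \<otimes> f (m - p))"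
proof -
  have inj: "inj_on (\<lambda>p. m - p) {p. p \<subseteq># m}"
    by (rule inj_on_inverseI[where g = "\<lambda>p. m - p"]) (simp add: mset_double_diff)
  have im: "(\<lambda>p. m - p) ` {p. p \<subseteq># m} = {p. p \<subseteq># m}"
    by (auto simp: image_iff) (metis diff_subset_eq_self mset_double_diff)
  have "(\<Oplus>p\<in>{p. p \<subseteq># m}. f p \<otimes> g (m - p)) = (\<Oplus>p\<in>(\<lambda>p. m - p) ` {p. p \<subseteq># m}. f p \<otimes> g (m - p))"
    by (simp only: im)
  also have "\<dots> = (\<Oplus>p\<in>{p. p \<subseteq># m}. f (m - p) \<otimes> g (m - (m - p)))"
    by (rule finsum_reindex[OF _ inj]) (use assms in auto)
  also have "\<dots> = (\<Oplus>p\<in>{p. p \<subseteq># m}. g p \<otimes> f (m - p))"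
    by (rule finsum_cong') (use assms in \<open>auto simp: m_comm mset_double_diff\<close>)
  finally show ?thesis .
qed

text \<open>Both sides sum over the factorizations of \<open>m\<close> into three monomials. On the
  left they are indexed by the product \<open>s\<close> of the first two and the first factor
  \<open>p\<close>, on the right by the first two factors; \<open>(s, p)\<close> corresponds to
  \<open>(p, s - p)\<close>.\<close>

lemma power_series_mult_assoc:
  assumes "\<And>m. f m \<in> carrier R" "\<And>m. g m \<in> carrier R" "\<And>m. h m \<in> carrier R"
  shows "(\<Oplus>s\<in>{s. s \<subseteq># m}. (\<Oplus>p\<in>{p. p \<subseteq># s}. f p \<otimes> g (s - p)) \<otimes> h (m - s)) =
    (\<Oplus>p\<in>{p. p \<subseteq># m}. f p \<otimes> (\<Oplus>q\<in>{q. q \<subseteq># m - p}. g q \<otimes> h (m - p - q)))"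
proof -
  let ?A = "Sigma {s. s \<subseteq># m} (\<lambda>s. {p. p \<subseteq># s})"
  let ?B = "Sigma {p. p \<subseteq># m} (\<lambda>p. {q. q \<subseteq># m - p})"
  let ?\<phi> = "\<lambda>(s, p). (p, s - p)"
  have inj: "inj_on ?\<phi> ?A"
    by (rule inj_on_inverseI[where g = "\<lambda>(p, q). (p + q, p)"]) (auto simp: subset_mset.add_diff_inverse)
  have im: "?\<phi> ` ?A = ?B"
  proof
    show "?\<phi> ` ?A \<subseteq> ?B"
      by (auto simp: subseteq_mset_def diff_le_mono intro: order_trans)
    show "?B \<subseteq> ?\<phi> ` ?A"
    proof (clarify)
      fix p q assume "p \<subseteq># m" "q \<subseteq># m - p"
      then have "p + q \<subseteq># m" by (metis subset_mset.le_diff_conv2 add.commute)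
      then show "(p, q) \<in> ?\<phi> ` ?A" by (intro image_eqI[where x = "(p + q, p)"]) auto
    qed
  qed
  have "(\<Oplus>s\<in>{s. s \<subseteq># m}. (\<Oplus>p\<in>{p. p \<subseteq># s}. f p \<otimes> g (s - p)) \<otimes> h (m - s)) =
      (\<Oplus>s\<in>{s. s \<subseteq># m}. \<Oplus>p\<in>{p. p \<subseteq># s}. f p \<otimes> g (s - p) \<otimes> h (m - s))"
    by (intro finsum_cong' refl finsum_ldistr) (use assms in auto)
  also have "\<dots> = (\<Oplus>z\<in>?A. case z of (s, p) \<Rightarrow> f p \<otimes> g (s - p) \<otimes> h (m - s))"
    by (rule finsum_Sigma) (use assms in auto)
  also have "\<dots> = (\<Oplus>x\<in>?A. (\<lambda>(p, q). f p \<otimes> (g q \<otimes> h (m - p - q))) (?\<phi> x))"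
    by (rule finsum_cong')
      (use assms in \<open>auto simp: m_assoc diff_diff_add_mset subset_mset.add_diff_inverse\<close>)
  also have "\<dots> = (\<Oplus>z\<in>?\<phi> ` ?A. case z of (p, q) \<Rightarrow> f p \<otimes> (g q \<otimes> h (m - p - q)))"
    by (rule finsum_reindex[OF _ inj, symmetric]) (use assms in auto)
  also have "\<dots> = (\<Oplus>p\<in>{p. p \<subseteq># m}. \<Oplus>q\<in>{q. q \<subseteq># m - p}. f p \<otimes> (g q \<otimes> h (m - p - q)))"
    unfolding im by (rule finsum_Sigma[symmetric]) (use assms in auto)
  also have "\<dots> = (\<Oplus>p\<in>{p. p \<subseteq># m}. f p \<otimes> (\<Oplus>q\<in>{q. q \<subseteq># m - p}. g q \<otimes> h (m - p - q)))"
    by (intro finsum_cong' refl finsum_rdistr[symmetric]) (use assms in auto)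
  finally show ?thesis .
qed

lemma finsum_single:
  assumes "finite A" "i \<in> A" "f i \<in> carrier R" "\<And>j. j \<in> A \<Longrightarrow> j \<noteq> i \<Longrightarrow> f j = \<zero>"
  shows "(\<Oplus>j\<in>A. f j) = f i"
proof -
  have "(\<Oplus>j\<in>A. f j) = (\<Oplus>j\<in>A. if i = j then f i else \<zero>)"
    by (rule finsum_cong') (use assms in auto)
  also have "\<dots> = f i" using assms finsum_singleton[of i A "\<lambda>_. f i"] by auto
  finally show ?thesis .
qed

lemma cring_power_series_ring: "cring (power_series_ring I)" (is "cring ?T")
proof (rule cringI)
  have closed: "f \<otimes>\<^bsub>?T\<^esub> g \<in> carrier ?T" if "f \<in> carrier ?T" "g \<in> carrier ?T" for f g
  proof -
    \<comment> \<open>If \<open>m\<close> contains a variable outside \<open>I\<close>, then so does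
      one of the factors \<open>p\<close> and \<open>m - p\<close>, and the corresponding
      coefficient vanishes.\<close>
    have "f p \<otimes> g (m - p) = \<zero>" if "p \<subseteq># m" "\<not> set_mset m \<subseteq> I" for m p
    proof -
      have "set_mset m = set_mset p \<union> set_mset (m - p)"
        using that(1) by (metis set_mset_union subset_mset.add_diff_inverse)
      then have "\<not> set_mset p \<subseteq> I \<or> \<not> set_mset (m - p) \<subseteq> I" using that(2) by blast
      then show ?thesis
        using \<open>f \<in> carrier ?T\<close> \<open>g \<in> carrier ?T\<close> by (auto simp: carrier_power_series_ring)
    qed
    then show ?thesis
      using that by (auto simp: carrier_power_series_ring mult_power_series_ring intro!: add.finprod_one_eqI finsum_closed)
  qed
  show "abelian_group ?T"
  proof (rule abelian_groupI)
    fix f assume f: "f \<in> carrier ?T"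
    show "\<exists>g\<in>carrier ?T. g \<oplus>\<^bsub>?T\<^esub> f = \<zero>\<^bsub>?T\<^esub>"
      by (rule bexI[where x = "\<lambda>m. \<ominus> f m"])
        (use f in \<open>auto simp: carrier_power_series_ring power_series_ring_simps l_neg\<close>)
  qed (auto simp: carrier_power_series_ring zero_power_series_ring add_power_series_ring a_ac)
  show "comm_monoid ?T"
  proof (rule comm_monoidI)
    fix f g h assume fgh: "f \<in> carrier ?T" "g \<in> carrier ?T" "h \<in> carrier ?T"
    show "f \<otimes>\<^bsub>?T\<^esub> g \<in> carrier ?T" by (rule closed) (use fgh in auto)
    show "f \<otimes>\<^bsub>?T\<^esub> g \<otimes>\<^bsub>?T\<^esub> h = f \<otimes>\<^bsub>?T\<^esub> (g \<otimes>\<^bsub>?T\<^esub> h)"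
      using fgh by (simp add: mult_power_series_ring carrier_power_series_ring power_series_mult_assoc)
    show "f \<otimes>\<^bsub>?T\<^esub> g = g \<otimes>\<^bsub>?T\<^esub> f"
      unfolding mult_power_series_ring
      using fgh by (intro ext power_series_mult_comm) (auto simp: carrier_power_series_ring)
    show "\<one>\<^bsub>?T\<^esub> \<otimes>\<^bsub>?T\<^esub> f = f"
    proof
      fix m
      have "(\<Oplus>p\<in>{p. p \<subseteq># m}. (if p = {#} then \<one> else \<zero>) \<otimes> f (m - p)) = \<one> \<otimes> f (m - {#})"
        by (subst finsum_single[where i = "{#}"]) (use fgh in \<open>auto simp: carrier_power_series_ring\<close>)
      then show "(\<one>\<^bsub>?T\<^esub> \<otimes>\<^bsub>?T\<^esub> f) m = f m"
        using fgh by (simp add: power_series_ring_simps carrier_power_series_ring)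
    qed
  qed (auto simp: carrier_power_series_ring one_power_series_ring)
  show "(f \<oplus>\<^bsub>?T\<^esub> g) \<otimes>\<^bsub>?T\<^esub> h = f \<otimes>\<^bsub>?T\<^esub> h \<oplus>\<^bsub>?T\<^esub> g \<otimes>\<^bsub>?T\<^esub> h"
    if "f \<in> carrier ?T" "g \<in> carrier ?T" "h \<in> carrier ?T" for f g h
  proof
    fix m
    have "(\<Oplus>p\<in>{p. p \<subseteq># m}. (f p \<oplus> g p) \<otimes> h (m - p)) =
        (\<Oplus>p\<in>{p. p \<subseteq># m}. f p \<otimes> h (m - p) \<oplus> g p \<otimes> h (m - p))"
      by (rule finsum_cong') (use that in \<open>auto simp: carrier_power_series_ring l_distr\<close>)
    also have "\<dots> = (\<Oplus>p\<in>{p. p \<subseteq># m}. f p \<otimes> h (m - p)) \<oplus> (\<Oplus>p\<in>{p. p \<subseteq># m}. g p \<otimes> h (m - p))"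
      by (rule finsum_addf) (use that in \<open>auto simp: carrier_power_series_ring\<close>)
    finally show "((f \<oplus>\<^bsub>?T\<^esub> g) \<otimes>\<^bsub>?T\<^esub> h) m = (f \<otimes>\<^bsub>?T\<^esub> h \<oplus>\<^bsub>?T\<^esub> g \<otimes>\<^bsub>?T\<^esub> h) m"
      by (simp only: add_power_series_ring mult_power_series_ring)
  qed
qed

section \<open>Variables and the ideals they generate\<close>

lemma indexed_var_eq: "indexed_var i = (\<lambda>m. if m = {#i#} then \<one> else \<zero>)"
  by (auto simp: indexed_var_def indexed_pmult_def indexed_const_def fun_eq_iff
      dest!: multi_member_split)

lemma indexed_var_carrier: "i \<in> I \<Longrightarrow> indexed_var i \<in> carrier (power_series_ring I)"
  by (auto simp: indexed_var_eq carrier_power_series_ring)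

text \<open>Only the divisor \<open>{#i#}\<close> of \<open>m\<close> contributes to the sum, so
  multiplication by a variable shifts coefficients.\<close>

lemma indexed_var_mult:
  assumes "f \<in> carrier (power_series_ring I)"
  shows "indexed_var i \<otimes>\<^bsub>power_series_ring I\<^esub> f = (\<lambda>m. if i \<in># m then f (m - {#i#}) else \<zero>)"
proof
  fix m
  have f: "f m \<in> carrier R" for m using assms by (simp add: carrier_power_series_ring)
  show "(indexed_var i \<otimes>\<^bsub>power_series_ring I\<^esub> f) m = (if i \<in># m then f (m - {#i#}) else \<zero>)"
  proof (cases "i \<in># m")
    case True
    then have "(\<Oplus>p\<in>{p. p \<subseteq># m}. indexed_var i p \<otimes> f (m - p)) = indexed_var i {#i#} \<otimes> f (m - {#i#})"
      by (intro finsum_single) (auto simp: indexed_var_eq f)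
    then show ?thesis using True f by (simp add: mult_power_series_ring) (simp add: indexed_var_eq)
  next
    case False
    then show ?thesis
      by (auto simp: mult_power_series_ring indexed_var_eq f intro!: add.finprod_one_eqI)
  qed
qed

text \<open>The ideal generated by the variables with index in \<open>G\<close>, described by
  coefficients: every monomial that occurs involves one of them. For finite
  \<open>G \<subseteq> I\<close> the agreement is \<open>genideal_indexed_var\<close>.\<close>

definition var_ideal :: "'c set \<Rightarrow> 'c set \<Rightarrow> ('c multiset \<Rightarrow> 'a) set" where
  "var_ideal I G = {f \<in> carrier (power_series_ring I). \<forall>m. set_mset m \<inter> G = {} \<longrightarrow> f m = \<zero>}"

lemma var_ideal_mono: "G \<subseteq> G' \<Longrightarrow> var_ideal I G \<subseteq> var_ideal I G'"
  unfolding var_ideal_def by blast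

text \<open>Every divisor of a monomial avoiding \<open>G\<close> avoids \<open>G\<close> too, so
  each term of the corresponding coefficient of a product has a vanishing factor.\<close>

lemma ideal_var_ideal: "ideal (var_ideal I G) (power_series_ring I)" (is "ideal ?J ?T")
proof -
  interpret T: cring ?T by (rule cring_power_series_ring)
  have mult: "f \<otimes>\<^bsub>?T\<^esub> g \<in> ?J" if "f \<in> ?J" "g \<in> carrier ?T" for f g
  proof -
    have "f p \<otimes> g (m - p) = \<zero>" if "p \<subseteq># m" "set_mset m \<inter> G = {}" for m p
    proof -
      have "set_mset p \<inter> G = {}" using that set_mset_mono[of p m] by blast
      then show ?thesis using \<open>f \<in> ?J\<close> \<open>g \<in> carrier ?T\<close>
        by (auto simp: carrier_power_series_ring var_ideal_def)
    qed
    moreover have "f \<otimes>\<^bsub>?T\<^esub> g \<in> carrier ?T" using that by (auto simp: var_ideal_def)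
    ultimately show ?thesis
      by (auto simp: var_ideal_def mult_power_series_ring intro!: add.finprod_one_eqI)
  qed
  have neg: "\<ominus>\<^bsub>?T\<^esub> f \<in> ?J" if "f \<in> ?J" for f
  proof -
    have fT: "f \<in> carrier ?T" using that by (simp add: var_ideal_def)
    have "f \<otimes>\<^bsub>?T\<^esub> (\<ominus>\<^bsub>?T\<^esub> \<one>\<^bsub>?T\<^esub>) \<in> ?J" using that by (intro mult) auto
    then show ?thesis using fT by (simp add: T.r_minus)
  qed
  show ?thesis
  proof (rule idealI)
    show "ring ?T" by (rule T.ring_axioms)
    show "subgroup ?J (add_monoid ?T)"
      by (rule T.add.subgroupI)
        (use neg in \<open>auto simp: var_ideal_def carrier_power_series_ring power_series_ring_simps
          a_inv_def intro!: exI[of _ "\<lambda>_. \<zero>"]\<close>)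
    show "f \<otimes>\<^bsub>?T\<^esub> g \<in> ?J" if "f \<in> ?J" "g \<in> carrier ?T" for f g using that by (rule mult)
    show "g \<otimes>\<^bsub>?T\<^esub> f \<in> ?J" if "f \<in> ?J" "g \<in> carrier ?T" for f g
      using mult[OF that] that by (subst T.m_comm) (auto simp: var_ideal_def)
  qed
qed

text \<open>Induction on \<open>G\<close>: collecting the monomials divisible by the new variable
  writes the series as that variable times \<open>g\<close>, plus a remainder \<open>h\<close> that
  belongs to the ideal of the previous variables.\<close>

lemma var_ideal_minimal:
  assumes "finite G" "G \<subseteq> I" and K: "ideal K (power_series_ring I)" "indexed_var ` G \<subseteq> K"
  shows "var_ideal I G \<subseteq> K"
  using assms(1,2,4)
proof (induction G)
  case empty
  have "var_ideal I {} = {\<zero>\<^bsub>power_series_ring I\<^esub>}"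
    by (auto simp: var_ideal_def carrier_power_series_ring zero_power_series_ring)
  then show ?case
    using additive_subgroup.zero_closed[OF ideal.axioms(1)[OF K(1)]] by simp
next
  case (insert i G)
  let ?T = "power_series_ring I"
  show ?case
  proof
    fix f assume f: "f \<in> var_ideal I (insert i G)"
    define g where "g = (\<lambda>m. f (add_mset i m))"
    define h where "h = (\<lambda>m. if i \<in># m then \<zero> else f m)"
    have fT: "f \<in> carrier ?T" using f by (simp add: var_ideal_def)
    have gT: "g \<in> carrier ?T"
      using fT insert.prems by (auto simp: g_def carrier_power_series_ring)
    have "h \<in> var_ideal I G"
      using f by (auto simp: h_def var_ideal_def carrier_power_series_ring)
    then have hK: "h \<in> K" using insert by auto
    have xK: "indexed_var i \<otimes>\<^bsub>?T\<^esub> g \<in> K"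
      using insert.prems gT by (intro ideal.I_r_closed[OF K(1)]) auto
    have "f = indexed_var i \<otimes>\<^bsub>?T\<^esub> g \<oplus>\<^bsub>?T\<^esub> h"
      using fT unfolding indexed_var_mult[OF gT] add_power_series_ring
      by (auto simp: fun_eq_iff g_def h_def carrier_power_series_ring)
    then show "f \<in> K"
      using additive_subgroup.a_closed[OF ideal.axioms(1)[OF K(1)] xK hK] by simp
  qed
qed

lemma indexed_var_in_var_ideal: "i \<in> G \<Longrightarrow> i \<in> I \<Longrightarrow> indexed_var i \<in> var_ideal I G"
  using indexed_var_carrier[of i I] by (auto simp: var_ideal_def indexed_var_eq)

lemma genideal_indexed_var:
  assumes "finite G" "G \<subseteq> I"
  shows "Idl\<^bsub>power_series_ring I\<^esub> (indexed_var ` G) = var_ideal I G"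
proof -
  interpret T: cring "power_series_ring I" by (rule cring_power_series_ring)
  have sub: "indexed_var ` G \<subseteq> carrier (power_series_ring I)"
    using assms(2) by (auto intro!: indexed_var_carrier)
  show ?thesis
  proof
    show "Idl\<^bsub>power_series_ring I\<^esub> (indexed_var ` G) \<subseteq> var_ideal I G"
    proof (rule T.genideal_minimal[OF ideal_var_ideal])
      show "indexed_var ` G \<subseteq> var_ideal I G"
        using assms(2) by (auto intro!: indexed_var_in_var_ideal)
    qed
    show "var_ideal I G \<subseteq> Idl\<^bsub>power_series_ring I\<^esub> (indexed_var ` G)"
      by (rule var_ideal_minimal[OF assms T.genideal_ideal[OF sub] T.genideal_self[OF sub]])
  qed
qed

text \<open>A variable outside \<open>G\<close> is regular modulo the ideal: adding \<open>i\<close>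
  to a monomial that avoids \<open>G\<close> gives another such monomial, at which the product has
  the original coefficient of \<open>f\<close>.\<close>

lemma var_ideal_cancel:
  assumes "f \<in> carrier (power_series_ring I)"
    and "indexed_var i \<otimes>\<^bsub>power_series_ring I\<^esub> f \<in> var_ideal I G" and "i \<notin> G"
  shows "f \<in> var_ideal I G"
proof -
  have "f m = \<zero>" if "set_mset m \<inter> G = {}" for m
  proof -
    have "(indexed_var i \<otimes>\<^bsub>power_series_ring I\<^esub> f) (add_mset i m) = \<zero>"
      using assms(2,3) that by (auto simp: var_ideal_def)
    then show ?thesis by (simp add: indexed_var_mult[OF assms(1)])
  qed
  then show ?thesis using assms(1) by (simp add: var_ideal_def)
qed

section \<open>Units of the power series ring\<close>

text \<open>The equation for the coefficient of the product at \<open>m\<close> can be solved for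
  \<open>g m\<close>, because there \<open>g m\<close> is multiplied by the invertible constant term
  of \<open>f\<close> and all other terms involve \<open>g\<close> only at smaller monomials. This
  defines the inverse \<open>g\<close> by recursion on the degree.\<close>

lemma power_series_unit:
  assumes f: "f \<in> carrier (power_series_ring I)" and "f {#} \<in> Units R"
  shows "f \<in> Units (power_series_ring I)"
proof -
  let ?T = "power_series_ring I"
  interpret T: cring ?T by (rule cring_power_series_ring)
  define u where "u = inv (f {#})"
  have u: "u \<in> carrier R" "f {#} \<otimes> u = \<one>" using assms(2) by (auto simp: u_def)
  have fR: "f m \<in> carrier R" for m using f by (simp add: carrier_power_series_ring)
  define D where "D m = {p. p \<subseteq># m \<and> p \<noteq> {#}}" for m :: "'c multiset"
  have finD: "finite (D m)" for m by (rule finite_subset[of _ "{p. p \<subseteq># m}"]) (auto simp: D_def)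
  define e where "e m = (if m = {#} then \<one> else \<zero>)" for m :: "'c multiset"
  \<comment> \<open>\<open>D m\<close> holds the nontrivial divisors of \<open>m\<close>, and
    \<open>e\<close> is the coefficient function of the unit series; \<open>F\<close> is the solved
    equation.\<close>
  define F where "F g m = u \<otimes> (e m \<ominus> (\<Oplus>p\<in>D m. f p \<otimes> g (m - p)))" for g m
  define g where "g = wfrec (measure size) F"
  have size: "size (m - p) < size m" if "p \<in> D m" for m p
    using that by (auto simp: D_def size_Diff_submset nonempty_has_size
        intro!: diff_less dest: size_mset_mono)
  \<comment> \<open>Well-founded recursion passes to \<open>F\<close> only the restriction of
    \<open>g\<close> to smaller monomials; on the arguments that \<open>F\<close> inspects it agrees
    with \<open>g\<close>.\<close>
  have cut: "cut g (measure size) m (m - p) = g (m - p)" if "p \<in> D m" for m p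
    using size[OF that] by (simp add: cut_apply)
  have unfold: "g m = F (cut g (measure size) m) m" for m
    unfolding g_def by (subst wfrec) auto
  have gR: "g m \<in> carrier R" for m
  proof (induction m rule: measure_induct_rule[of size])
    case (less m)
    then show ?case
      unfolding unfold[of m] F_def using size
      by (auto simp: cut e_def fR u intro!: finsum_closed)
  qed
  have g: "g m = u \<otimes> (e m \<ominus> (\<Oplus>p\<in>D m. f p \<otimes> g (m - p)))" for m
  proof -
    have "(\<Oplus>p\<in>D m. f p \<otimes> cut g (measure size) m (m - p)) = (\<Oplus>p\<in>D m. f p \<otimes> g (m - p))"
      by (rule finsum_cong') (auto simp: cut fR gR)
    then show ?thesis by (simp add: unfold[of m] F_def)
  qed
  \<comment> \<open>The inverse involves no variable outside \<open>I\<close>: for such an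
    \<open>m\<close>, either \<open>p\<close> or the smaller monomial \<open>m - p\<close> contains
    an outside variable, and the induction hypothesis covers the latter case.\<close>
  have g0: "g m = \<zero>" if "\<not> set_mset m \<subseteq> I" for m
    using that
  proof (induction m rule: measure_induct_rule[of size])
    case (less m)
    have "f p \<otimes> g (m - p) = \<zero>" if p: "p \<in> D m" for p
    proof -
      have "set_mset m = set_mset p \<union> set_mset (m - p)"
        using p by (metis (no_types, lifting) D_def mem_Collect_eq set_mset_union subset_mset.add_diff_inverse)
      then have "\<not> set_mset p \<subseteq> I \<or> \<not> set_mset (m - p) \<subseteq> I" using less.prems by blast
      then have "f p = \<zero> \<or> g (m - p) = \<zero>"
        using f less.IH[OF size[OF p]] by (auto simp only: carrier_power_series_ring)
      then show ?thesis using gR fR by auto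
    qed
    then have "(\<Oplus>p\<in>D m. f p \<otimes> g (m - p)) = \<zero>" by (intro add.finprod_one_eqI)
    then show ?case using less.prems u by (subst g) (auto simp: e_def minus_eq)
  qed
  have gT: "g \<in> carrier ?T" using gR g0 by (simp add: carrier_power_series_ring)
  have "f \<otimes>\<^bsub>?T\<^esub> g = \<one>\<^bsub>?T\<^esub>"
  proof
    fix m
    define S where "S = (\<Oplus>p\<in>D m. f p \<otimes> g (m - p))"
    have S: "S \<in> carrier R" unfolding S_def by (rule finsum_closed) (auto simp: fR gR)
    have e: "e m \<in> carrier R" by (simp add: e_def)
    have "{p. p \<subseteq># m} = insert {#} (D m)" by (auto simp: D_def)
    then have "(f \<otimes>\<^bsub>?T\<^esub> g) m = f {#} \<otimes> g m \<oplus> S"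
      by (simp add: mult_power_series_ring S_def)
        (subst finsum_insert, auto simp: finD fR gR D_def)
    also have "f {#} \<otimes> g m = (f {#} \<otimes> u) \<otimes> (e m \<ominus> S)"
      using m_assoc[OF fR u(1) minus_closed[OF e S]] by (simp only: g[of m] S_def)
    also have "\<dots> \<oplus> S = e m" using S e u by (simp add: minus_eq a_assoc l_neg)
    finally show "(f \<otimes>\<^bsub>?T\<^esub> g) m = \<one>\<^bsub>?T\<^esub> m" by (simp add: one_power_series_ring e_def)
  qed
  then show ?thesis using f gT T.m_comm[OF f gT] by (auto simp: Units_def)
qed

end

section \<open>Depth of a ring glued from quotients\<close>

text \<open>A proper ideal contains no unit and therefore lies in \<open>\<mm>\<close>. The form as
  an equivalence lets the definite description in \<open>depth\<close> be evaluated.\<close>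

lemma (in cring) maximalideal_unique:
  assumes "ideal \<mm> R" "\<mm> \<noteq> carrier R" and units: "carrier R - \<mm> \<subseteq> Units R"
  shows "maximalideal J R \<longleftrightarrow> J = \<mm>"
proof -
  have proper: "J \<subseteq> \<mm>" if J: "ideal J R" "J \<noteq> carrier R" for J
  proof
    fix x assume x: "x \<in> J"
    show "x \<in> \<mm>"
    proof (rule ccontr)
      assume "x \<notin> \<mm>"
      then have "x \<in> Units R" using x units ideal.Icarr[OF J(1)] by blast
      then have "inv x \<otimes> x = \<one>" "inv x \<in> carrier R" by auto
      then have "\<one> \<in> J" using ideal.I_l_closed[OF J(1) x] by metis
      then show False using ideal.one_imp_carrier[OF J(1)] J(2) by blast
    qed
  qed
  show ?thesis
  proof
    assume "maximalideal J R"
    then interpret J: maximalideal J R .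
    show "J = \<mm>"
      using J.I_maximal[OF assms(1) proper[OF J.is_ideal J.I_notcarr[symmetric]]] assms
        additive_subgroup.a_subset[OF ideal.axioms(1)[OF assms(1)]] by blast
  next
    assume "J = \<mm>"
    moreover have "maximalideal \<mm> R"
    proof (rule maximalidealI[OF assms(1)])
      show "carrier R \<noteq> \<mm>" using assms(2) by blast
      show "K = \<mm> \<or> K = carrier R" if "ideal K R" "\<mm> \<subseteq> K" "K \<subseteq> carrier R" for K
        using proper[OF that(1)] that(2) by blast
    qed
    ultimately show "maximalideal J R" by simp
  qed
qed

context cring
begin

lemma carrier_Quot: "carrier (R Quot I) = (\<lambda>x. I +> x) ` carrier R"
  by (auto simp: FactRing_def A_RCOSETS_def')

lemma Quot_coset_eq_iff:
  assumes "ideal I R" "x \<in> carrier R" "y \<in> carrier R"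
  shows "I +> x = I +> y \<longleftrightarrow> x \<ominus> y \<in> I"
  using quotient_eq_iff_same_a_r_cos[OF assms] by blast

lemma Quot_add:
  assumes "ideal I R" "x \<in> carrier R" "y \<in> carrier R"
  shows "(I +> x) \<oplus>\<^bsub>R Quot I\<^esub> (I +> y) = I +> (x \<oplus> y)"
  using ring_hom_add[OF ideal.rcos_ring_hom[OF assms(1)] assms(2,3)] by simp

lemma Quot_mult:
  assumes "ideal I R" "x \<in> carrier R" "y \<in> carrier R"
  shows "(I +> x) \<otimes>\<^bsub>R Quot I\<^esub> (I +> y) = I +> (x \<otimes> y)"
  using ring_hom_mult[OF ideal.rcos_ring_hom[OF assms(1)] assms(2,3)] by simp

lemma Quot_one: "\<one>\<^bsub>R Quot I\<^esub> = I +> \<one>"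
  by (simp add: FactRing_def)

lemma Quot_zero: "ideal I R \<Longrightarrow> \<zero>\<^bsub>R Quot I\<^esub> = I +> \<zero>"
  using a_rcos_zero[of I] additive_subgroup.zero_closed[OF ideal.axioms(1)]
  by (auto simp: FactRing_def)

lemma ideal_diff:
  assumes "ideal I R" "x \<in> I" "y \<in> I" shows "x \<ominus> y \<in> I"
  using assms by (simp add: a_minus_def ideal.axioms(1) additive_subgroup.a_closed
      additive_subgroup.a_inv_closed)

lemma ideal_diff_cancel:
  assumes I: "ideal I R" and "x \<ominus> y \<in> I" "x \<in> carrier R" "y \<in> carrier R"
  shows "x \<in> I \<longleftrightarrow> y \<in> I"
proof
  assume "y \<in> I"
  then have "x \<ominus> y \<oplus> y \<in> I" using assms by (meson additive_subgroup.a_closed ideal.axioms(1))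
  then show "x \<in> I" using assms by (simp add: minus_eq a_assoc l_neg)
next
  assume "x \<in> I"
  then have "x \<ominus> (x \<ominus> y) \<in> I" using ideal_diff[OF I] assms by blast
  also have "x \<ominus> (x \<ominus> y) = y" using assms by algebra
  finally show "y \<in> I" .
qed

lemma Quot_coset_mem_iff:
  assumes "ideal I R" "ideal J R" "I \<subseteq> J" "x \<in> carrier R"
  shows "I +> x \<in> (\<lambda>x. I +> x) ` J \<longleftrightarrow> x \<in> J"
proof
  assume "I +> x \<in> (\<lambda>x. I +> x) ` J"
  then obtain y where y: "y \<in> J" "I +> x = I +> y" by blast
  have yR: "y \<in> carrier R" using ideal.Icarr[OF assms(2) y(1)] .
  then have "x \<ominus> y \<in> J" using y Quot_coset_eq_iff[OF assms(1,4) yR] assms(3) by blast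
  then show "x \<in> J" using ideal_diff_cancel[OF assms(2)] y(1) yR assms(4) by blast
qed blast

text \<open>The sum is \<open>(P + I) + x\<close>, and \<open>P + I = P\<close> because
  \<open>I \<subseteq> P\<close>. This evaluates the components of \<open>diagonal\<close> on a
  coset.\<close>

lemma set_add_coset:
  assumes "ideal P R" "ideal I R" "I \<subseteq> P" "x \<in> carrier R"
  shows "P <+>\<^bsub>R\<^esub> (I +> x) = P +> x"
proof -
  have IR: "I \<subseteq> carrier R" "P \<subseteq> carrier R"
    using assms(1,2) additive_subgroup.a_subset ideal.axioms(1) by blast+
  have "P <+>\<^bsub>R\<^esub> I = P"
  proof
    show "P <+>\<^bsub>R\<^esub> I \<subseteq> P"
      using assms(1,3) additive_subgroup.a_closed[OF ideal.axioms(1)[OF assms(1)]]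
      by (auto simp: set_add_def')
    show "P \<subseteq> P <+>\<^bsub>R\<^esub> I"
    proof
      fix p assume "p \<in> P"
      then have "p \<oplus> \<zero> \<in> P <+>\<^bsub>R\<^esub> I"
        using additive_subgroup.zero_closed[OF ideal.axioms(1)[OF assms(2)]]
        unfolding set_add_def' by blast
      then show "p \<in> P <+>\<^bsub>R\<^esub> I" using \<open>p \<in> P\<close> IR by (simp add: subset_iff)
    qed
  qed
  then show ?thesis using a_setmult_rcos_assoc[OF IR(2,1) assms(4)] by simp
qed

text \<open>An element outside \<open>\<mm>\<close> has an inverse, and the class of this inverse is
  inverse to its class; so the quotient is again local, with the image of \<open>\<mm>\<close> as
  maximal ideal.\<close>

lemma maximalideal_Quot:
  assumes \<mm>: "ideal \<mm> R" "\<mm> \<noteq> carrier R" "carrier R - \<mm> \<subseteq> Units R"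
    and I: "ideal I R" "I \<subseteq> \<mm>"
  shows "maximalideal J (R Quot I) \<longleftrightarrow> J = (\<lambda>x. I +> x) ` \<mm>"
proof -
  interpret A: cring "R Quot I" by (rule ideal.quotient_is_cring[OF I(1) is_cring])
  show ?thesis
  proof (rule A.maximalideal_unique)
    show "ideal ((\<lambda>x. I +> x) ` \<mm>) (R Quot I)" by (rule ring_ideal_imp_quot_ideal[OF I(1) \<mm>(1)])
    have "\<one> \<notin> \<mm>" using ideal.one_imp_carrier[OF \<mm>(1)] \<mm>(2) by blast
    then have "I +> \<one> \<notin> (\<lambda>x. I +> x) ` \<mm>" using Quot_coset_mem_iff[OF I(1) \<mm>(1) I(2)] by blast
    then show "(\<lambda>x. I +> x) ` \<mm> \<noteq> carrier (R Quot I)" by (auto simp: carrier_Quot)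
    show "carrier (R Quot I) - (\<lambda>x. I +> x) ` \<mm> \<subseteq> Units (R Quot I)"
    proof
      fix C assume "C \<in> carrier (R Quot I) - (\<lambda>x. I +> x) ` \<mm>"
      then obtain x where x: "x \<in> carrier R" "C = I +> x" "x \<notin> \<mm>" by (auto simp: carrier_Quot)
      then have "x \<in> Units R" using \<mm>(3) by blast
      then have "(I +> inv x) \<otimes>\<^bsub>R Quot I\<^esub> C = \<one>\<^bsub>R Quot I\<^esub>" "I +> inv x \<in> carrier (R Quot I)"
          "C \<in> carrier (R Quot I)"
        using x by (auto simp: Quot_mult[OF I(1)] Quot_one carrier_Quot)
      moreover from this have "C \<otimes>\<^bsub>R Quot I\<^esub> (I +> inv x) = \<one>\<^bsub>R Quot I\<^esub>"
        using A.m_comm by metis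
      ultimately show "C \<in> Units (R Quot I)" unfolding Units_def by blast
    qed
  qed
qed

section \<open>Gluing two quotients along the maximal ideal\<close>

text \<open>In \<open>R / P \<times> R / Q\<close> the conclusion reads
  \<open>t (1, 0) = (w, w)\<close>: the element \<open>w\<close> is congruent to \<open>t\<close>
  modulo \<open>P\<close> and vanishes modulo \<open>Q\<close>.\<close>

lemma set_add_splitE:
  assumes "ideal P R" "ideal Q R" "t \<in> P <+>\<^bsub>R\<^esub> Q"
  obtains w where "w \<in> Q" "w \<ominus> t \<in> P"
proof -
  obtain p w where pw: "p \<in> P" "w \<in> Q" "t = p \<oplus> w" using assms(3) by (auto simp: set_add_def')
  have c: "p \<in> carrier R" "w \<in> carrier R"
    using pw ideal.Icarr[OF assms(1)] ideal.Icarr[OF assms(2)] by auto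
  have "w \<ominus> t = \<ominus> p" using c pw(3) by algebra
  then have "w \<ominus> t \<in> P"
    using pw(1) additive_subgroup.a_inv_closed[OF ideal.axioms(1)[OF assms(1)]] by simp
  with pw(2) that show ?thesis by blast
qed

context
  fixes P Q \<mm>
  assumes P: "ideal P R" and Q: "ideal Q R"
    and \<mm>: "ideal \<mm> R" "\<mm> \<noteq> carrier R" "carrier R - \<mm> \<subseteq> Units R"
    and split: "\<mm> = P <+>\<^bsub>R\<^esub> Q"
begin

private lemma P_le: "P \<subseteq> \<mm>" and Q_le: "Q \<subseteq> \<mm>"
proof -
  have "p \<oplus> q \<in> \<mm>" if "p \<in> P" "q \<in> Q" for p q using that split by (auto simp: set_add_def')
  moreover have "\<zero> \<in> P" "\<zero> \<in> Q"
    using P Q additive_subgroup.zero_closed[OF ideal.axioms(1)] by auto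
  ultimately show "P \<subseteq> \<mm>" "Q \<subseteq> \<mm>"
    using ideal.Icarr[OF P] ideal.Icarr[OF Q] by (metis r_zero subsetI, metis l_zero subsetI)
qed

private lemma one_notin: "\<one> \<notin> \<mm>"
  using ideal.one_imp_carrier[OF \<mm>(1)] \<mm>(2) by blast

text \<open>In the application \<open>P\<close> is \<open>P1\<close> and \<open>Q\<close> is
  \<open>P2 \<inter> P3\<close>. The element \<open>h\<close> is regular modulo
  \<open>P \<inter> Q\<close>. The assumptions on \<open>q\<close> and \<open>p\<close>, the latter
  being \<open>(Q : P) = Q\<close>, transfer regularity modulo \<open>P \<inter> Q\<close> to each
  of the two ideals; they show that \<open>w\<close> is not a multiple of \<open>y\<close>, since
  otherwise the idempotent \<open>(1, 0)\<close> would come from an element \<open>s\<close> with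
  \<open>s \<in> Q\<close> and \<open>\<one> \<ominus> s \<in> P\<close>.\<close>

lemma depth_Quot_inter_eq_1:
  assumes h: "h \<in> \<mm>" "\<And>s. s \<in> carrier R \<Longrightarrow> h \<otimes> s \<in> P \<inter> Q \<Longrightarrow> s \<in> P \<inter> Q"
    and q: "q \<in> Q" "\<And>s. s \<in> carrier R \<Longrightarrow> q \<otimes> s \<in> P \<Longrightarrow> s \<in> P"
    and p: "\<And>s. s \<in> carrier R \<Longrightarrow> (\<And>p. p \<in> P \<Longrightarrow> p \<otimes> s \<in> Q) \<Longrightarrow> s \<in> Q"
  shows "depth (R Quot (P \<inter> Q)) (self_module (R Quot (P \<inter> Q))) = 1"
proof -
  let ?I = "P \<inter> Q"
  let ?A = "R Quot ?I"
  let ?J = "(\<lambda>x. ?I +> x) ` \<mm>"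
  have I: "ideal ?I R" by (rule i_intersect[OF P Q])
  have I_le: "?I \<subseteq> \<mm>" using P_le by blast
  interpret A: cring ?A by (rule ideal.quotient_is_cring[OF I is_cring])
  interpret M: module ?A "self_module ?A" by (rule module_self_module[OF A.is_cring])
  have J: "ideal ?J ?A" by (rule ring_ideal_imp_quot_ideal[OF I \<mm>(1)])
  have sel: "carrier (self_module ?A) = carrier ?A" "a \<odot>\<^bsub>self_module ?A\<^esub> b = a \<otimes>\<^bsub>?A\<^esub> b"
    "\<zero>\<^bsub>self_module ?A\<^esub> = ?I +> \<zero>" "a \<oplus>\<^bsub>self_module ?A\<^esub> b = a \<oplus>\<^bsub>?A\<^esub> b" for a b
    by (simp_all add: restrict_scalars_def Quot_zero[OF I])
  have \<mm>R: "x \<in> carrier R" if "x \<in> \<mm>" for x using ideal.Icarr[OF \<mm>(1) that] .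
  have I0: "?I +> x = ?I +> \<zero> \<longleftrightarrow> x \<in> ?I" if "x \<in> carrier R" for x
    using Quot_coset_eq_iff[OF I that zero_closed] that by (simp add: minus_eq)
  have nzd: "nonzerodivisor_on (self_module ?A) (?I +> y) \<longleftrightarrow>
      (\<forall>s\<in>carrier R. y \<otimes> s \<in> ?I \<longrightarrow> s \<in> ?I)" if "y \<in> carrier R" for y
    using that by (simp add: nonzerodivisor_on_def sel carrier_Quot Quot_mult[OF I] I0)
  \<comment> \<open>The products stay in the proper ideal \<open>?J\<close>, which omits the class
    of \<open>\<one>\<close>; hence the depth is not infinite by convention.\<close>
  have "set_smult ?A (self_module ?A) ?J \<subseteq> ?J"
  proof (rule M.set_smult_minimal)
    show "submodule ?J ?A (self_module ?A)"
    proof (rule M.submoduleI_smult)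
      show "?J \<subseteq> carrier (self_module ?A)" using \<mm>R by (auto simp: sel carrier_Quot)
      show "\<zero>\<^bsub>self_module ?A\<^esub> \<in> ?J"
        using additive_subgroup.zero_closed[OF ideal.axioms(1)[OF \<mm>(1)]] by (auto simp: sel)
      show "a \<oplus>\<^bsub>self_module ?A\<^esub> b \<in> ?J" if "a \<in> ?J" "b \<in> ?J" for a b
        using additive_subgroup.a_closed[OF ideal.axioms(1)[OF J] that] by (simp only: sel)
      show "a \<odot>\<^bsub>self_module ?A\<^esub> b \<in> ?J" if "a \<in> carrier ?A" "b \<in> ?J" for a b
        using ideal.I_l_closed[OF J that(2,1)] by (simp only: sel)
    qed
    show "a \<odot>\<^bsub>self_module ?A\<^esub> x \<in> ?J" if "a \<in> ?J" "x \<in> carrier (self_module ?A)" for a x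
      using that ideal.I_r_closed[OF J that(1), of x] by (simp only: sel)
  qed
  moreover have "?I +> \<one> \<notin> ?J" using one_notin Quot_coset_mem_iff[OF I \<mm>(1) I_le] by blast
  moreover have "?I +> \<one> \<in> carrier (self_module ?A)" by (simp add: sel carrier_Quot)
  ultimately have neq: "set_smult ?A (self_module ?A) ?J \<noteq> carrier (self_module ?A)" by blast
  have "ideal_depth ?A ?J (self_module ?A) = 1"
  proof (rule M.ideal_depth_eq_1[OF _ neq])
    show "?J \<subseteq> carrier ?A" using \<mm>R by (auto simp: carrier_Quot)
    show "?I +> h \<in> ?J" using h(1) by blast
    show "nonzerodivisor_on (self_module ?A) (?I +> h)" using h nzd[OF \<mm>R] by blast
    fix Y assume "Y \<in> ?J" "nonzerodivisor_on (self_module ?A) Y"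
    then obtain y where y: "y \<in> \<mm>" "Y = ?I +> y"
      and reg: "\<And>s. s \<in> carrier R \<Longrightarrow> y \<otimes> s \<in> ?I \<Longrightarrow> s \<in> ?I"
      using nzd[OF \<mm>R] by auto
    have yR: "y \<in> carrier R" by (rule \<mm>R[OF y(1)])
    obtain w where w: "w \<in> Q" "w \<ominus> y \<in> P"
      using set_add_splitE[OF P Q] y(1) split by blast
    have wR: "w \<in> carrier R" using ideal.Icarr[OF Q w(1)] .
    have img: "(\<lambda>v. Y \<odot>\<^bsub>self_module ?A\<^esub> v) ` carrier (self_module ?A) =
        (\<lambda>s. ?I +> (y \<otimes> s)) ` carrier R"
      using yR by (simp add: sel carrier_Quot y(2) image_image Quot_mult[OF I] cong: image_cong)
    show "\<exists>w\<in>carrier (self_module ?A). w \<notin> (\<lambda>v. Y \<odot>\<^bsub>self_module ?A\<^esub> v) ` carrier (self_module ?A) \<and>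
        (\<forall>z\<in>?J. z \<odot>\<^bsub>self_module ?A\<^esub> w \<in> (\<lambda>v. Y \<odot>\<^bsub>self_module ?A\<^esub> v) ` carrier (self_module ?A))"
      unfolding img
    proof (intro bexI conjI ballI)
      show "?I +> w \<in> carrier (self_module ?A)" using wR by (auto simp: sel carrier_Quot)
      show "?I +> w \<notin> (\<lambda>s. ?I +> (y \<otimes> s)) ` carrier R"
      proof
        assume "?I +> w \<in> (\<lambda>s. ?I +> (y \<otimes> s)) ` carrier R"
        then obtain s where s: "s \<in> carrier R" "?I +> w = ?I +> (y \<otimes> s)" by blast
        then have ws: "w \<ominus> y \<otimes> s \<in> ?I" using Quot_coset_eq_iff[OF I] wR yR by simp
        then have ysQ: "y \<otimes> s \<in> Q" using ideal_diff_cancel[OF Q _ wR] w(1) s(1) yR by blast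
        \<comment> \<open>Regularity of \<open>y\<close> is known only modulo \<open>?I\<close>.
          Multiplying \<open>y \<otimes> s \<in> Q\<close> by elements of \<open>P\<close> lands in
          \<open>?I\<close>, where \<open>y\<close> can be cancelled.\<close>
        have "s \<in> Q"
        proof (rule p[OF s(1)])
          fix a assume a: "a \<in> P"
          have aR: "a \<in> carrier R" by (rule ideal.Icarr[OF P a])
          have "a \<otimes> (y \<otimes> s) \<in> ?I"
            using ideal.I_r_closed[OF P a] ideal.I_l_closed[OF Q ysQ aR] s(1) yR by simp
          also have "a \<otimes> (y \<otimes> s) = y \<otimes> (a \<otimes> s)" using aR s(1) yR by algebra
          finally show "a \<otimes> s \<in> Q" using reg[of "a \<otimes> s"] aR s(1) by blast
        qed
        \<comment> \<open>The same device with the roles exchanged: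
          \<open>y \<otimes> (\<one> \<ominus> s)\<close> lies in \<open>P\<close>, and multiplying
          by \<open>q \<in> Q\<close> moves it into \<open>?I\<close>.\<close>
        moreover have "\<one> \<ominus> s \<in> P"
        proof (rule q(2))
          have qR: "q \<in> carrier R" by (rule ideal.Icarr[OF Q q(1)])
          have "(w \<ominus> y \<otimes> s) \<ominus> (w \<ominus> y) \<in> P" using ideal_diff[OF P] ws w(2) by blast
          also have "(w \<ominus> y \<otimes> s) \<ominus> (w \<ominus> y) = y \<otimes> (\<one> \<ominus> s)" using wR yR s(1) by algebra
          finally have "q \<otimes> (y \<otimes> (\<one> \<ominus> s)) \<in> ?I"
            using ideal.I_l_closed[OF P _ qR] ideal.I_r_closed[OF Q q(1)] yR s(1) by simp
          also have "q \<otimes> (y \<otimes> (\<one> \<ominus> s)) = y \<otimes> (q \<otimes> (\<one> \<ominus> s))" using qR yR s(1) by algebra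
          finally show "q \<otimes> (\<one> \<ominus> s) \<in> P" using reg[of "q \<otimes> (\<one> \<ominus> s)"] qR s(1) by simp
        qed (use s(1) in simp)
        \<comment> \<open>Both \<open>s\<close> and \<open>\<one> \<ominus> s\<close> lie in
          \<open>\<mm>\<close>, hence so would \<open>\<one>\<close>.\<close>
        ultimately show False
          using one_notin P_le Q_le ideal_diff_cancel[OF \<mm>(1) _ one_closed s(1)] by blast
      qed
      fix Z assume "Z \<in> ?J"
      then obtain z where z: "z \<in> \<mm>" "Z = ?I +> z" by blast
      obtain v where v: "v \<in> Q" "v \<ominus> z \<in> P"
        using set_add_splitE[OF P Q] z(1) split by blast
      have c: "z \<in> carrier R" "v \<in> carrier R" using \<mm>R[OF z(1)] ideal.Icarr[OF Q v(1)] .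
      \<comment> \<open>The product \<open>z w\<close> equals \<open>y v\<close> modulo
        \<open>?I\<close>, as both represent \<open>z y (1, 0)\<close>. Modulo \<open>Q\<close> both
        vanish; modulo \<open>P\<close> both are congruent to \<open>z y\<close>.\<close>
      have "z \<otimes> w \<ominus> y \<otimes> v \<in> Q"
        using ideal_diff[OF Q] ideal.I_l_closed[OF Q] w(1) v(1) c yR by blast
      moreover have "z \<otimes> (w \<ominus> y) \<ominus> y \<otimes> (v \<ominus> z) \<in> P"
        using ideal_diff[OF P] ideal.I_l_closed[OF P] w(2) v(2) c yR by blast
      moreover have "z \<otimes> (w \<ominus> y) \<ominus> y \<otimes> (v \<ominus> z) = z \<otimes> w \<ominus> y \<otimes> v"
        using c yR wR by algebra
      ultimately have "?I +> (z \<otimes> w) = ?I +> (y \<otimes> v)"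
        using Quot_coset_eq_iff[OF I, of "z \<otimes> w" "y \<otimes> v"] c yR wR by simp
      then show "Z \<odot>\<^bsub>self_module ?A\<^esub> (?I +> w) \<in> (\<lambda>s. ?I +> (y \<otimes> s)) ` carrier R"
        using c wR by (auto simp: sel z(2) Quot_mult[OF I])
    qed
  qed
  then show ?thesis
    using maximalideal_Quot[OF \<mm> I I_le] by (simp add: depth_def)
qed

end

text \<open>The socle element is the class of \<open>e = (1, 0, 0)\<close>. The submodule
  \<open>L\<close> of triples whose first two entries agree modulo \<open>\<mm>\<close> shows both
  that this class is nonzero and that the maximal ideal times the cokernel is not
  everything.\<close>

lemma depth_cokernel_diagonal_eq_0:
  assumes P1: "ideal P1 R" and P2: "ideal P2 R" and P3: "ideal P3 R"
    and \<mm>: "ideal \<mm> R" "\<mm> \<noteq> carrier R" "carrier R - \<mm> \<subseteq> Units R"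
    and split: "\<mm> = P1 <+>\<^bsub>R\<^esub> P2 \<inter> P3" and P2_le: "P2 \<subseteq> \<mm>"
    and A: "A = R Quot (P1 \<inter> P2 \<inter> P3)"
    and B: "B = RDirProd (R Quot P1) (RDirProd (R Quot P2) (R Quot P3))"
    and \<delta>: "\<delta> = diagonal R P1 P2 P3"
  shows "depth A (quot_module (restrict_scalars \<delta> B) (\<delta> ` carrier A)) = 0"
proof -
  let ?I = "P1 \<inter> P2 \<inter> P3"
  let ?J = "(\<lambda>x. ?I +> x) ` \<mm>"
  let ?c = "\<lambda>a b c. (P1 +> a, P2 +> b, P3 +> c)"
  have Q: "ideal (P2 \<inter> P3) R" by (rule i_intersect[OF P2 P3])
  have I: "ideal ?I R" using i_intersect[OF P1 Q] by (simp add: Int_assoc)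
  have P1_le: "P1 \<subseteq> \<mm>"
  proof
    fix p assume "p \<in> P1"
    moreover have "\<zero> \<in> P2 \<inter> P3" using Q additive_subgroup.zero_closed[OF ideal.axioms(1)] by blast
    ultimately have "p \<oplus> \<zero> \<in> \<mm>" unfolding split set_add_def' by blast
    then show "p \<in> \<mm>" using ideal.Icarr[OF P1 \<open>p \<in> P1\<close>] by simp
  qed
  then have I_le: "?I \<subseteq> \<mm>" by blast
  have one_notin: "\<one> \<notin> \<mm>" using ideal.one_imp_carrier[OF \<mm>(1)] \<mm>(2) by blast
  have \<mm>R: "x \<in> carrier R" if "x \<in> \<mm>" for x using ideal.Icarr[OF \<mm>(1) that] .
  interpret A: cring A unfolding A by (rule ideal.quotient_is_cring[OF I is_cring])
  have ringB: "ring B"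
    unfolding B by (intro RDirProd_ring ideal.quotient_is_ring P1 P2 P3)
  have carB: "x \<in> carrier B \<longleftrightarrow> (\<exists>a\<in>carrier R. \<exists>b\<in>carrier R. \<exists>c\<in>carrier R. x = ?c a b c)" for x
    by (cases x) (auto simp: B RDirProd_carrier carrier_Quot)
  have opB: "?c a b c \<oplus>\<^bsub>B\<^esub> ?c a' b' c' = ?c (a \<oplus> a') (b \<oplus> b') (c \<oplus> c')"
    "?c a b c \<otimes>\<^bsub>B\<^esub> ?c a' b' c' = ?c (a \<otimes> a') (b \<otimes> b') (c \<otimes> c')"
    if "a \<in> carrier R" "b \<in> carrier R" "c \<in> carrier R" "a' \<in> carrier R" "b' \<in> carrier R" "c' \<in> carrier R"
    for a b c a' b' c'
    using that by (simp_all add: B RDirProd_def DirProd_def monoid.defs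
        Quot_add[OF P1] Quot_add[OF P2] Quot_add[OF P3] Quot_mult[OF P1] Quot_mult[OF P2] Quot_mult[OF P3])
  have zeroB: "\<zero>\<^bsub>B\<^esub> = ?c \<zero> \<zero> \<zero>"
    by (simp add: B RDirProd_def DirProd_def monoid.defs Quot_zero P1 P2 P3)
  have oneB: "\<one>\<^bsub>B\<^esub> = ?c \<one> \<one> \<one>"
    by (simp add: B RDirProd_def DirProd_def monoid.defs Quot_one)
  have eqB: "?c a b c = ?c a' b' c' \<longleftrightarrow> a \<ominus> a' \<in> P1 \<and> b \<ominus> b' \<in> P2 \<and> c \<ominus> c' \<in> P3"
    if "a \<in> carrier R" "b \<in> carrier R" "c \<in> carrier R" "a' \<in> carrier R" "b' \<in> carrier R" "c' \<in> carrier R"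
    for a b c a' b' c'
    using that by (simp add: Quot_coset_eq_iff P1 P2 P3)
  have \<delta>_coset: "\<delta> (?I +> t) = ?c t t t" if "t \<in> carrier R" for t
    unfolding \<delta> diagonal_def using that
    by (simp add: set_add_coset[OF P1 I] set_add_coset[OF P2 I] set_add_coset[OF P3 I] Int_lower1 Int_lower2 le_infI1)
  have hom: "\<delta> \<in> ring_hom A B"
  proof (rule ring_hom_memI)
    show "\<delta> a \<in> carrier B" if "a \<in> carrier A" for a
      using that unfolding A carrier_Quot carB by (auto simp: \<delta>_coset)
    show "\<delta> (a \<otimes>\<^bsub>A\<^esub> b) = \<delta> a \<otimes>\<^bsub>B\<^esub> \<delta> b" "\<delta> (a \<oplus>\<^bsub>A\<^esub> b) = \<delta> a \<oplus>\<^bsub>B\<^esub> \<delta> b"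
      if "a \<in> carrier A" "b \<in> carrier A" for a b
      using that unfolding A carrier_Quot
      by (auto simp: \<delta>_coset opB Quot_mult[OF I] Quot_add[OF I])
    show "\<delta> \<one>\<^bsub>A\<^esub> = \<one>\<^bsub>B\<^esub>" unfolding A Quot_one oneB by (simp add: \<delta>_coset)
  qed
  let ?N = "\<delta> ` carrier A"
  let ?M = "restrict_scalars \<delta> B"
  interpret M: module A ?M by (rule module_restrict_scalars[OF A.is_cring ringB hom])
  have N: "submodule ?N A ?M" by (rule submodule_restrict_scalars_image[OF A.is_cring ringB hom])
  interpret MN: module A "quot_module ?M ?N" by (rule M.module_quot_module[OF N])
  have Neq: "?N = (\<lambda>t. ?c t t t) ` carrier R"
    by (simp add: A carrier_Quot image_image \<delta>_coset cong: image_cong)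
  have carM: "carrier ?M = carrier B" "\<zero>\<^bsub>?M\<^esub> = \<zero>\<^bsub>B\<^esub>" "x \<oplus>\<^bsub>?M\<^esub> y = x \<oplus>\<^bsub>B\<^esub> y" for x y
    by (simp_all add: restrict_scalars_def)
  have smultM: "(?I +> t) \<odot>\<^bsub>?M\<^esub> ?c a b c = ?c (t \<otimes> a) (t \<otimes> b) (t \<otimes> c)"
    if "t \<in> carrier R" "a \<in> carrier R" "b \<in> carrier R" "c \<in> carrier R" for t a b c
    using that by (simp add: restrict_scalars_def \<delta>_coset opB)
  define e where "e = ?c \<one> \<zero> \<zero>"
  have eM: "e \<in> carrier ?M" unfolding e_def carM carB by blast
  \<comment> \<open>Because \<open>P1\<close> and \<open>P2\<close> lie in \<open>\<mm>\<close>,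
    agreement of the first two entries modulo \<open>\<mm>\<close> does not depend on
    representatives. It holds on the diagonal and on multiples by \<open>\<mm>\<close>, but fails
    for \<open>e\<close>.\<close>
  define L where "L = {?c a b c |a b c. a \<in> carrier R \<and> b \<in> carrier R \<and> c \<in> carrier R \<and> a \<ominus> b \<in> \<mm>}"
  have L: "submodule L A ?M"
  proof (rule M.submoduleI_smult)
    show "L \<subseteq> carrier ?M" unfolding carM L_def by (auto simp: carB)
    have "\<zero> \<ominus> \<zero> \<in> \<mm>"
      using additive_subgroup.zero_closed[OF ideal.axioms(1)[OF \<mm>(1)]] by (simp add: minus_eq)
    then show "\<zero>\<^bsub>?M\<^esub> \<in> L" unfolding carM zeroB L_def by blast
    show "x \<oplus>\<^bsub>?M\<^esub> y \<in> L" if "x \<in> L" "y \<in> L" for x y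
    proof -
      obtain a b c where x: "x = ?c a b c" "a \<in> carrier R" "b \<in> carrier R" "c \<in> carrier R" "a \<ominus> b \<in> \<mm>"
        using \<open>x \<in> L\<close> unfolding L_def by blast
      obtain a' b' c' where y: "y = ?c a' b' c'" "a' \<in> carrier R" "b' \<in> carrier R" "c' \<in> carrier R"
          "a' \<ominus> b' \<in> \<mm>"
        using \<open>y \<in> L\<close> unfolding L_def by blast
      have "(a \<ominus> b) \<oplus> (a' \<ominus> b') \<in> \<mm>"
        using x(5) y(5) additive_subgroup.a_closed[OF ideal.axioms(1)[OF \<mm>(1)]] by blast
      also have "(a \<ominus> b) \<oplus> (a' \<ominus> b') = (a \<oplus> a') \<ominus> (b \<oplus> b')" using x(2-3) y(2-3) by algebra
      finally have "(a \<oplus> a') \<ominus> (b \<oplus> b') \<in> \<mm>" .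
      moreover have "x \<oplus>\<^bsub>?M\<^esub> y = ?c (a \<oplus> a') (b \<oplus> b') (c \<oplus> c')"
        unfolding carM x(1) y(1) using x y by (intro opB)
      ultimately show ?thesis unfolding L_def using x y by blast
    qed
    show "T \<odot>\<^bsub>?M\<^esub> x \<in> L" if "T \<in> carrier A" "x \<in> L" for T x
    proof -
      obtain a b c where x: "x = ?c a b c" "a \<in> carrier R" "b \<in> carrier R" "c \<in> carrier R" "a \<ominus> b \<in> \<mm>"
        using \<open>x \<in> L\<close> unfolding L_def by blast
      obtain t where t: "t \<in> carrier R" "T = ?I +> t"
        using \<open>T \<in> carrier A\<close> unfolding A carrier_Quot by blast
      have "t \<otimes> (a \<ominus> b) \<in> \<mm>" using ideal.I_l_closed[OF \<mm>(1) x(5) t(1)] .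
      also have "t \<otimes> (a \<ominus> b) = t \<otimes> a \<ominus> t \<otimes> b" using x(2-3) t(1) by algebra
      finally have "t \<otimes> a \<ominus> t \<otimes> b \<in> \<mm>" .
      moreover have "T \<odot>\<^bsub>?M\<^esub> x = ?c (t \<otimes> a) (t \<otimes> b) (t \<otimes> c)"
        unfolding t(2) x(1) using x t by (intro smultM)
      ultimately show ?thesis unfolding L_def using x t by blast
    qed
  qed
  have NL: "?N \<subseteq> L"
  proof -
    have "t \<ominus> t \<in> \<mm>" if "t \<in> carrier R" for t
      using that additive_subgroup.zero_closed[OF ideal.axioms(1)[OF \<mm>(1)]] by (simp add: minus_eq r_neg)
    then show ?thesis unfolding Neq L_def by blast
  qed
  have JA: "?J \<subseteq> carrier A" using \<mm>R by (auto simp: A carrier_Quot)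
  have JL: "T \<odot>\<^bsub>?M\<^esub> x \<in> L" if "T \<in> ?J" "x \<in> carrier ?M" for T x
  proof -
    obtain t where t: "t \<in> \<mm>" "T = ?I +> t" using \<open>T \<in> ?J\<close> by blast
    obtain a b c where x: "x = ?c a b c" "a \<in> carrier R" "b \<in> carrier R" "c \<in> carrier R"
      using \<open>x \<in> carrier ?M\<close> unfolding carM carB by blast
    have tR: "t \<in> carrier R" by (rule \<mm>R[OF t(1)])
    have "t \<otimes> a \<ominus> t \<otimes> b \<in> \<mm>"
      using ideal_diff[OF \<mm>(1)] ideal.I_r_closed[OF \<mm>(1) t(1)] x by blast
    moreover have "T \<odot>\<^bsub>?M\<^esub> x = ?c (t \<otimes> a) (t \<otimes> b) (t \<otimes> c)"
      unfolding t(2) x(1) using x tR by (intro smultM)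
    ultimately show ?thesis unfolding L_def using x tR by blast
  qed
  have eL: "e \<notin> L"
  proof
    assume "e \<in> L"
    then obtain a b c where abc: "a \<in> carrier R" "b \<in> carrier R" "c \<in> carrier R" "a \<ominus> b \<in> \<mm>"
      "?c \<one> \<zero> \<zero> = ?c a b c"
      unfolding L_def e_def by blast
    then have "\<one> \<ominus> a \<in> \<mm>" "\<zero> \<ominus> b \<in> \<mm>" 
      using P1_le P2_le eqB[OF one_closed zero_closed zero_closed abc(1-3)] by blast+
    then have "\<one> \<in> \<mm>" "\<zero> \<in> \<mm>"
      using ideal_diff_cancel[OF \<mm>(1)] abc additive_subgroup.zero_closed[OF ideal.axioms(1)[OF \<mm>(1)]]
      by (metis one_closed zero_closed)+
    with one_notin show False by blast
  qed
  have "ideal_depth A ?J (quot_module ?M ?N) = 0"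
  proof (rule MN.ideal_depth_eq_0[OF M.set_smult_quot_module_neq[OF N L NL JA JL eM eL]])
    show "?N +>\<^bsub>?M\<^esub> e \<in> carrier (quot_module ?M ?N)"
      using eM by (auto simp: M.carrier_quot_module)
    have rcos: "?N +>\<^bsub>?M\<^esub> x = ?N \<longleftrightarrow> x \<in> ?N" if "x \<in> carrier ?M" for x
    proof -
      interpret S: abelian_subgroup ?N ?M by (rule M.submodule_abelian_subgroup[OF N])
      show ?thesis using that by (metis S.a_rcos_const S.a_rcos_self)
    qed
    have zero: "\<zero>\<^bsub>quot_module ?M ?N\<^esub> = ?N" by (rule M.zero_quot_module[OF N])
    show "?N +>\<^bsub>?M\<^esub> e \<noteq> \<zero>\<^bsub>quot_module ?M ?N\<^esub>"
      unfolding zero rcos[OF eM] using eL NL by blast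
    fix T assume T: "T \<in> ?J"
    then obtain t where t: "t \<in> \<mm>" "T = ?I +> t" by blast
    have tR: "t \<in> carrier R" by (rule \<mm>R[OF t(1)])
    obtain w where w: "w \<in> P2 \<inter> P3" "w \<ominus> t \<in> P1"
      using set_add_splitE[OF P1 Q] t(1) split by blast
    have wR: "w \<in> carrier R" using ideal.Icarr[OF Q w(1)] .
    have "T \<odot>\<^bsub>?M\<^esub> e = ?c t \<zero> \<zero>"
      unfolding t(2) e_def using smultM[OF tR one_closed zero_closed zero_closed] tR by simp
    \<comment> \<open>The choice of \<open>w\<close> gives \<open>w \<equiv> t\<close> modulo
      \<open>P1\<close> and \<open>w \<equiv> 0\<close> modulo \<open>P2\<close> and
      \<open>P3\<close>, so the multiple of \<open>e\<close> is diagonal.\<close>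
    also have "\<dots> = ?c w w w"
    proof -
      have "\<ominus> (w \<ominus> t) \<in> P1" using w(2) additive_subgroup.a_inv_closed[OF ideal.axioms(1)[OF P1]] by blast
      also have "\<ominus> (w \<ominus> t) = t \<ominus> w" using wR tR by algebra
      finally have 1: "t \<ominus> w \<in> P1" .
      have 2: "\<zero> \<ominus> w \<in> P2 \<inter> P3"
        by (rule ideal_diff[OF Q _ w(1)]) (use Q additive_subgroup.zero_closed[OF ideal.axioms(1)] in blast)
      show ?thesis using 1 2 eqB[OF tR zero_closed zero_closed wR wR wR] by blast
    qed
    also have "\<dots> \<in> ?N" unfolding Neq using wR by blast
    finally have TN: "T \<odot>\<^bsub>?M\<^esub> e \<in> ?N" .
    have TA: "T \<in> carrier A" using T JA by blast
    show "T \<odot>\<^bsub>quot_module ?M ?N\<^esub> (?N +>\<^bsub>?M\<^esub> e) = \<zero>\<^bsub>quot_module ?M ?N\<^esub>"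
      unfolding M.smult_quot_module[OF N TA eM] zero rcos[OF M.smult_closed[OF TA eM]] by (rule TN)
  qed
  then show ?thesis
    using maximalideal_Quot[OF \<mm> I I_le] by (simp add: depth_def A)
qed

end

section \<open>The three ideals of variables in a power series ring over a field\<close>

theorem proposition5p6:
  fixes k :: "('a, 'b) ring_scheme" and m n :: nat
  assumes "field k"
    and "m \<ge> 4" and "n \<ge> 6"
    and "2 / 3 * real n \<ge> real m" and "real m \<ge> 1 / 2 * real n + 1"
    and "T = ring.power_series_ring k {1..n}"
    and "x = ring.indexed_var k"
    and "F1 = x ` {1..m}"
    and "F2 = x ` {n - m + 1..n}"
    and "F3 = x ` {m + 1..n} \<union> x ` {1..2 * m - n}"
    and "P1 = Idl\<^bsub>T\<^esub> F1" and "P2 = Idl\<^bsub>T\<^esub> F2" and "P3 = Idl\<^bsub>T\<^esub> F3"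
    and "A = T Quot (P1 \<inter> P2 \<inter> P3)"
    and "B = RDirProd (T Quot P1) (RDirProd (T Quot P2) (T Quot P3))"
    and "\<delta> = diagonal T P1 P2 P3"
  shows "depth A (quot_module (restrict_scalars \<delta> B) (\<delta> ` carrier A)) = 0
    \<and> depth A (self_module A) = 1"
proof -
  interpret k: field k by fact
  define I where "I = {1..n}"
  define G1 where "G1 = {1..m}"
  define G2 where "G2 = {n - m + 1..n}"
  define G3 where "G3 = {m + 1..n} \<union> {1..2 * m - n}"
  note G_defs = I_def G1_def G2_def G3_def
  \<comment> \<open>Over the naturals these bounds yield \<open>m \<le> n \<le> 2 * m\<close>, so
    the subtractions \<open>n - m\<close> and \<open>2 * m - n\<close> are exact.\<close>
  have mn: "3 * m \<le> 2 * n" "n + 2 \<le> 2 * m" using assms(4,5) by linarith+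
  have T: "T = k.power_series_ring I" and x: "x = k.indexed_var"
    by (simp_all add: assms(6,7) I_def)
  interpret T: cring T unfolding T by (rule k.cring_power_series_ring)
  have G_le: "G1 \<subseteq> I" "G2 \<subseteq> I" "G3 \<subseteq> I" using mn by (auto simp: G_defs)
  have P_eq: "P1 = k.var_ideal I G1" "P2 = k.var_ideal I G2" "P3 = k.var_ideal I G3"
    using k.genideal_indexed_var[of G1 I] k.genideal_indexed_var[of G2 I]
      k.genideal_indexed_var[of G3 I] G_le assms(8-13)
    by (simp_all add: T x G1_def G2_def G3_def image_Un)
  have P: "ideal P1 T" "ideal P2 T" "ideal P3 T"
    unfolding P_eq T by (rule k.ideal_var_ideal)+
  have Q: "ideal (P2 \<inter> P3) T" by (rule T.i_intersect[OF P(2,3)])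
  have xT: "x i \<in> carrier T" if "i \<in> I" for i
    unfolding x T using that by (rule k.indexed_var_carrier)
  have xP: "i \<in> I \<Longrightarrow> i \<in> G1 \<Longrightarrow> x i \<in> P1" "i \<in> I \<Longrightarrow> i \<in> G2 \<Longrightarrow> x i \<in> P2"
    "i \<in> I \<Longrightarrow> i \<in> G3 \<Longrightarrow> x i \<in> P3" for i
    unfolding P_eq x by (auto intro: k.indexed_var_in_var_ideal)
  have cancel: "i \<notin> G1 \<Longrightarrow> x i \<otimes>\<^bsub>T\<^esub> s \<in> P1 \<Longrightarrow> s \<in> P1" "i \<notin> G2 \<Longrightarrow> x i \<otimes>\<^bsub>T\<^esub> s \<in> P2 \<Longrightarrow> s \<in> P2"
    "i \<notin> G3 \<Longrightarrow> x i \<otimes>\<^bsub>T\<^esub> s \<in> P3 \<Longrightarrow> s \<in> P3" if "s \<in> carrier T" for i s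
    using that unfolding P_eq x T by (auto intro: k.var_ideal_cancel)

  define \<mm> where "\<mm> = k.var_ideal I I"
  have \<mm>_ideal: "ideal \<mm> T" unfolding \<mm>_def T by (rule k.ideal_var_ideal)
  \<comment> \<open>The only monomial in the variables from \<open>I\<close> that avoids
    \<open>I\<close> is the constant one, so membership is vanishing of the constant term. Over a
    field the series outside \<open>\<mm>\<close> are therefore units.\<close>
  have mem_\<mm>: "f \<in> \<mm> \<longleftrightarrow> f \<in> carrier T \<and> f {#} = \<zero>\<^bsub>k\<^esub>" for f
  proof -
    have "\<not> set_mset p \<subseteq> I" if "set_mset p \<inter> I = {}" "p \<noteq> {#}" for p
      using that by (cases p) auto
    then show ?thesis
      unfolding \<mm>_def T by (auto simp: k.var_ideal_def k.carrier_power_series_ring)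
  qed
  have \<mm>_neq: "\<mm> \<noteq> carrier T"
    using mem_\<mm>[of "\<one>\<^bsub>T\<^esub>"] T.one_closed by (auto simp: T k.one_power_series_ring)
  have \<mm>_units: "carrier T - \<mm> \<subseteq> Units T"
  proof
    fix f assume f: "f \<in> carrier T - \<mm>"
    then have "f {#} \<in> Units k"
      using mem_\<mm>[of f] by (auto simp: k.field_Units T k.carrier_power_series_ring)
    then show "f \<in> Units T" using f unfolding T by (auto intro: k.power_series_unit)
  qed
  have P_le: "P1 \<subseteq> \<mm>" "P2 \<subseteq> \<mm>" "P3 \<subseteq> \<mm>"
    unfolding P_eq \<mm>_def using G_le by (auto intro!: k.var_ideal_mono)

  have split: "\<mm> = P1 <+>\<^bsub>T\<^esub> P2 \<inter> P3"
  proof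
    have "ideal (P1 <+>\<^bsub>T\<^esub> P2 \<inter> P3) T" by (rule T.add_ideals[OF P(1) Q])
    moreover have "x i \<in> P1 <+>\<^bsub>T\<^esub> P2 \<inter> P3" if i: "i \<in> I" for i
    proof (cases "i \<in> G1")
      case True
      then have "x i \<oplus>\<^bsub>T\<^esub> \<zero>\<^bsub>T\<^esub> \<in> P1 <+>\<^bsub>T\<^esub> P2 \<inter> P3"
        using xP(1)[OF i] additive_subgroup.zero_closed[OF ideal.axioms(1)[OF Q]]
        unfolding set_add_def' by blast
      then show ?thesis using xT[OF i] by simp
    next
      case False
      \<comment> \<open>Here \<open>i > m\<close>, which puts \<open>i\<close> in the first block of
        \<open>G3\<close>; from \<open>n + 2 \<le> 2 * m\<close> also
        \<open>n - m + 1 \<le> i\<close>.\<close>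
      then have "i \<in> G2" "i \<in> G3" using i mn by (auto simp: G_defs)
      then have "\<zero>\<^bsub>T\<^esub> \<oplus>\<^bsub>T\<^esub> x i \<in> P1 <+>\<^bsub>T\<^esub> P2 \<inter> P3"
        using xP(2,3)[OF i] additive_subgroup.zero_closed[OF ideal.axioms(1)[OF P(1)]]
        unfolding set_add_def' by blast
      then show ?thesis using xT[OF i] by simp
    qed
    ultimately show "\<mm> \<subseteq> P1 <+>\<^bsub>T\<^esub> P2 \<inter> P3"
      unfolding \<mm>_def T x by (intro k.var_ideal_minimal) (auto simp: I_def)
    have "p \<oplus>\<^bsub>T\<^esub> q \<in> \<mm>" if "p \<in> P1" "q \<in> P2 \<inter> P3" for p q
      using that P_le additive_subgroup.a_closed[OF ideal.axioms(1)[OF \<mm>_ideal]] by blast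
    then show "P1 <+>\<^bsub>T\<^esub> P2 \<inter> P3 \<subseteq> \<mm>" unfolding set_add_def' by blast
  qed

  have mem: "1 \<in> I" "m \<in> I" "n \<in> I" using assms(2) mn by (auto simp: I_def)
  \<comment> \<open>Each of the three index sets omits exactly one of \<open>1\<close>,
    \<open>m\<close>, \<open>n\<close>: \<open>G1\<close> omits \<open>n\<close>, \<open>G2\<close>
    omits \<open>1\<close> and \<open>G3\<close> omits \<open>m\<close>. So \<open>h\<close> reduces
    to a single variable modulo each ideal.\<close>
  have G: "1 \<in> G1" "1 \<notin> G2" "1 \<in> G3" "m \<in> G1" "m \<in> G2" "m \<notin> G3" "n \<notin> G1" "n \<in> G2" "n \<in> G3"
    using assms(2) mn by (auto simp: G_defs)
  define h where "h = x 1 \<oplus>\<^bsub>T\<^esub> (x m \<oplus>\<^bsub>T\<^esub> x n)"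
  note c = xT[OF mem(1)] xT[OF mem(2)] xT[OF mem(3)]
  have one: "depth A (self_module A) = 1"
    unfolding assms(14) Int_assoc
  proof (rule T.depth_Quot_inter_eq_1[OF P(1) Q \<mm>_ideal \<mm>_neq \<mm>_units split])
    have "x i \<in> \<mm>" if "i \<in> I" for i
      unfolding \<mm>_def x using that by (intro k.indexed_var_in_var_ideal)
    then show "h \<in> \<mm>"
      unfolding h_def using mem additive_subgroup.a_closed[OF ideal.axioms(1)[OF \<mm>_ideal]] by blast
    show "s \<in> P1 \<inter> (P2 \<inter> P3)" if s: "s \<in> carrier T" and hs: "h \<otimes>\<^bsub>T\<^esub> s \<in> P1 \<inter> (P2 \<inter> P3)" for s
    proof -
      \<comment> \<open>Subtracting the multiples of the two variables that lie in the ideal leaves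
        the third variable times \<open>s\<close>, to which \<open>cancel\<close> applies.\<close>
      have sub: "x i \<otimes>\<^bsub>T\<^esub> s \<in> P"
        if "ideal P T" "h \<otimes>\<^bsub>T\<^esub> s \<in> P" "x j \<in> P" "x l \<in> P" "h = x i \<oplus>\<^bsub>T\<^esub> (x j \<oplus>\<^bsub>T\<^esub> x l)"
          "x i \<in> carrier T" for P i j l
      proof -
        have d: "x j \<in> carrier T" "x l \<in> carrier T" using ideal.Icarr[OF that(1)] that(3,4) by auto
        have "(x j \<oplus>\<^bsub>T\<^esub> x l) \<otimes>\<^bsub>T\<^esub> s \<in> P"
          using ideal.I_r_closed[OF that(1) _ s] that(3,4)
            additive_subgroup.a_closed[OF ideal.axioms(1)[OF that(1)]] by blast
        then have "h \<otimes>\<^bsub>T\<^esub> s \<ominus>\<^bsub>T\<^esub> (x j \<oplus>\<^bsub>T\<^esub> x l) \<otimes>\<^bsub>T\<^esub> s \<in> P"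
          using T.ideal_diff[OF that(1,2)] by blast
        also have "h \<otimes>\<^bsub>T\<^esub> s \<ominus>\<^bsub>T\<^esub> (x j \<oplus>\<^bsub>T\<^esub> x l) \<otimes>\<^bsub>T\<^esub> s = x i \<otimes>\<^bsub>T\<^esub> s"
          unfolding that(5) using d that(6) s by algebra
        finally show ?thesis .
      qed
      have perm: "h = x n \<oplus>\<^bsub>T\<^esub> (x 1 \<oplus>\<^bsub>T\<^esub> x m)" "h = x m \<oplus>\<^bsub>T\<^esub> (x 1 \<oplus>\<^bsub>T\<^esub> x n)"
        unfolding h_def using c by (simp_all add: T.a_ac)
      have "s \<in> P1"
        using cancel(1)[OF s G(7)] sub[OF P(1) _ _ _ perm(1) c(3)] hs xP(1) mem G by blast
      moreover have "s \<in> P2"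
        using cancel(2)[OF s G(2)] sub[OF P(2) _ _ _ h_def c(1)] hs xP(2) mem G by blast
      moreover have "s \<in> P3"
        using cancel(3)[OF s G(6)] sub[OF P(3) _ _ _ perm(2) c(2)] hs xP(3) mem G by blast
      ultimately show ?thesis by blast
    qed
    \<comment> \<open>The variable \<open>x n\<close> serves as \<open>q\<close>: it lies in
      \<open>P2 \<inter> P3\<close> and, as \<open>n \<notin> G1\<close>, is regular modulo
      \<open>P1\<close>.\<close>
    show "x n \<in> P2 \<inter> P3" using xP mem G by blast
    show "s \<in> P1" if "s \<in> carrier T" "x n \<otimes>\<^bsub>T\<^esub> s \<in> P1" for s using cancel(1) that G by blast
    \<comment> \<open>Two elements of \<open>P1\<close> suffice as multipliers: \<open>x 1\<close>
      can be cancelled modulo \<open>P2\<close>, and \<open>x m\<close> modulo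
      \<open>P3\<close>.\<close>
    show "s \<in> P2 \<inter> P3" if s: "s \<in> carrier T" "\<And>p. p \<in> P1 \<Longrightarrow> p \<otimes>\<^bsub>T\<^esub> s \<in> P2 \<inter> P3" for s
      using cancel(2)[OF s(1) G(2)] cancel(3)[OF s(1) G(6)] s(2) xP(1) mem G by blast
  qed
  have "depth A (quot_module (restrict_scalars \<delta> B) (\<delta> ` carrier A)) = 0"
    by (rule T.depth_cokernel_diagonal_eq_0[OF P \<mm>_ideal \<mm>_neq \<mm>_units split P_le(2) assms(14-16)])
  with one show ?thesis by blast
qed

end
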